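(* Let $N$ be a positive integer and let $f\in L^2$ be real-valued and $2\pi$-periodic. There exists a unique map $U$ from $[0,\infty)$ to the real-valued elements of $S_N$ such that $$(U_t+UU_x+U_{xxx}-U_{xxxxx},\phi)=0\quad\text{for all }\phi\in S_N,\ t\ge0,\qquad U(0)=P_Nf.$$ Moreover, this solution satisfies, for all $t\ge 0$, $$\frac{d}{dt}\int_{-\pi}^{\pi}U(x,t)\,dx=0,\qquad \frac{d}{dt}\int_{-\pi}^{\pi}U^2(x,t)\,dx=0,$$ $$\frac{d}{dt}\int_{-\pi}^{\pi}\left(\tfrac13U^3-U_x^2-U_{xx}^2\right)(x,t)\,dx=0.$$
   Context: All functions are $2\pi$-periodic in $x$; function spaces are on $[-\pi,\pi]$. $(f,g)=\int_{-\pi}^{\pi} f\,\overline{g}\,dx$ is the $L^2$ inner product. $S_N=\mathrm{span}\{e^{ikx}: k\in\mathbb Z,\ -N\le k\le N\}$ and $P_N$ is the $L^2$-orthogonal projection onto $S_N$. *)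

theory Defs
  imports "HOL-Analysis.Analysis"
begin

text \<open>Functions of \<open>x\<close> are defined on all of the real line; integrals are over one period.\<close>

abbreviation period_measure :: "real measure" where
  "period_measure \<equiv> lebesgue_on {-pi..pi}"

text \<open>A function in this sense represents its almost-everywhere class.\<close>

definition square_integrable_per :: "(real \<Rightarrow> real) \<Rightarrow> bool" where
  "square_integrable_per f \<longleftrightarrow>
     f \<in> borel_measurable period_measure \<and> integrable period_measure (\<lambda>x. (f x)\<^sup>2)"

definition periodic_2pi :: "(real \<Rightarrow> 'a) \<Rightarrow> bool" where
  "periodic_2pi f \<longleftrightarrow> (\<forall>x. f (x + 2 * pi) = f x)"

definition L2_inner :: "(real \<Rightarrow> complex) \<Rightarrow> (real \<Rightarrow> complex) \<Rightarrow> complex" where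
  "L2_inner f g = (LINT x|period_measure. f x * cnj (g x))"

definition trig_space :: "nat \<Rightarrow> (real \<Rightarrow> complex) set" where
  "trig_space N =
     {f. \<exists>c :: int \<Rightarrow> complex.
           f = (\<lambda>x. \<Sum>k\<in>{- int N..int N}. c k * exp (\<i> * of_int k * complex_of_real x))}"

definition real_trig_space :: "nat \<Rightarrow> (real \<Rightarrow> real) set" where
  "real_trig_space N = {u. (\<lambda>x. complex_of_real (u x)) \<in> trig_space N}"

text \<open>Elements of \<^term>\<open>trig_space N\<close> are analytic, so the projection determines an actual function
  and not only an almost-everywhere class.\<close>

definition L2_proj :: "nat \<Rightarrow> (real \<Rightarrow> complex) \<Rightarrow> real \<Rightarrow> complex" where
  "L2_proj N f =
     (THE g. g \<in> trig_space N \<and> (\<forall>\<phi>\<in>trig_space N. L2_inner (\<lambda>x. f x - g x) \<phi> = 0))"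

text \<open>A space-time function is written \<open>U t x\<close>. The time derivative is taken relative to
  the time interval \<open>[0,\<infinity>)\<close>, hence is one-sided at \<open>t = 0\<close>.\<close>

definition time_deriv :: "(real \<Rightarrow> real \<Rightarrow> real) \<Rightarrow> real \<Rightarrow> real \<Rightarrow> real" where
  "time_deriv U t x = vector_derivative (\<lambda>s. U s x) (at t within {0..})"

definition kawahara_residual :: "(real \<Rightarrow> real \<Rightarrow> real) \<Rightarrow> real \<Rightarrow> real \<Rightarrow> real" where
  "kawahara_residual U t x =
     time_deriv U t x + U t x * deriv (U t) x + (deriv ^^ 3) (U t) x - (deriv ^^ 5) (U t) x"

text \<open>Solutions are extensional functions on \<open>[0,\<infinity>)\<close>, so that uniqueness is not
  affected by values at negative times. Differentiability in time is pointwise in \<open>x\<close>; since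
  \<^term>\<open>real_trig_space N\<close> is finite-dimensional this is the same as differentiability of
  \<open>t \<mapsto> U t\<close> in any norm.\<close>

definition galerkin_solution :: "nat \<Rightarrow> (real \<Rightarrow> real) \<Rightarrow> (real \<Rightarrow> real \<Rightarrow> real) \<Rightarrow> bool" where
  "galerkin_solution N f U \<longleftrightarrow>
     U \<in> {0..} \<rightarrow>\<^sub>E real_trig_space N \<and>
     (\<forall>t\<ge>0. \<forall>x. (\<lambda>s. U s x) differentiable (at t within {0..})) \<and>
     (\<forall>t\<ge>0. \<forall>\<phi>\<in>trig_space N.
        L2_inner (\<lambda>x. complex_of_real (kawahara_residual U t x)) \<phi> = 0) \<and>
     (\<lambda>x. complex_of_real (U 0 x)) = L2_proj N (\<lambda>x. complex_of_real (f x))"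

end

theory Submission
  imports Defs "HOL-Probability.Discrete_Topology"
begin

text \<open>Translates of the Dirichlet kernel to \<open>2 N + 1\<close> equispaced nodes form a real orthogonal
  basis of \<open>S\<^sub>N\<close> whose coordinates are point values. In these coordinates pointwise
  differentiability in time is differentiability of finitely many functions, and the Galerkin
  equation is a quadratic system of ordinary differential equations that conserves the Euclidean
  norm, hence has global solutions. Uniqueness is Gronwall's inequality for the \<open>L\<^sup>2\<close> norm
  of a difference. With \<open>G = U\<^sup>2 / 2 + U\<^sub>x\<^sub>x - U\<^sub>x\<^sub>x\<^sub>x\<^sub>x\<close> the equation reads
  \<open>U\<^sub>t = - P\<^sub>N G\<^sub>x\<close>; the conservation laws come from the test functions \<open>1\<close>,
  \<open>U\<close> and \<open>P\<^sub>N G\<close>.\<close>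

subsection \<open>Global solutions of ordinary differential equations\<close>

text \<open>The nodes only change coordinates: the scheme stays Galerkin and does not become
  collocation. A product of two elements of the space has degree at most 2N, where the rule with
  2N+1 equispaced nodes is exact, so the Euclidean norm of the point values is the L2 norm up to a
  constant factor. The nonlinear term tested with a basis function can reach degree 3N, beyond that
  exactness; the coefficients of the system therefore remain integrals. Real coordinates in a real
  basis also make the constructed solution real-valued. The main obstacle to global existence is
  that the field is quadratic, hence only locally Lipschitz. It is altered outside a large ball, so
  that one global fixed point argument replaces the continuation of local solutions. All
  integrations by parts are done by exhibiting a periodic potential of the whole integrand.\<close>

lemma at_within_Icc_eq_Ici:
  fixes t :: real
  assumes "0 \<le> t"
  shows "at t within {0..t+1} = at t within {0..}"
  by (rule at_within_nhd[where S = "{..<t+1}"]) auto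

text \<open>Integrating the exponential gains the factor 1/l. This gain is what beats the Lipschitz
  constant in the Picard iteration.\<close>

lemma norm_integral_le_exp:
  fixes g :: "real \<Rightarrow> 'a::banach"
  assumes "0 \<le> t" "0 < l" "0 \<le> C" "continuous_on {0..t} g"
    and le: "\<And>s. 0 \<le> s \<Longrightarrow> s \<le> t \<Longrightarrow> norm (g s) \<le> C * exp (l * s)"
  shows "norm (integral {0..t} g) \<le> C * exp (l * t) / l"
proof -
  have "((\<lambda>s. C * exp (l * s)) has_integral (C * exp (l * t) / l - C * exp (l * 0) / l)) {0..t}"
    by (rule fundamental_theorem_of_calculus)
      (use assms in \<open>auto intro!: derivative_eq_intros simp: has_real_derivative_iff_has_vector_derivative[symmetric]\<close>)
  then have "norm (integral {0..t} g) \<le> C * exp (l * t) / l - C * exp (l * 0) / l"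
    by (intro integral_norm_bound_integral[THEN order_trans])
      (use assms in \<open>auto simp: has_integral_iff intro: integrable_continuous_real\<close>)
  also have "\<dots> \<le> C * exp (l * t) / l"
    using assms by simp
  finally show ?thesis .
qed

text \<open>The weight \<open>exp (- l * t)\<close> with \<open>l > L\<close> makes the Picard map a contraction
  on all of \<open>[0,\<infinity>)\<close> at once.\<close>

lemma lipschitz_ode_global_solution:
  fixes F :: "'a::banach \<Rightarrow> 'a"
  assumes L: "L-lipschitz_on UNIV F"
  obtains u where "u 0 = u0"
    and "\<And>t. 0 \<le> t \<Longrightarrow> (u has_vector_derivative F (u t)) (at t within {0..})"
proof -
  \<comment> \<open>The contraction factor will be L / l, which is at most 1/2 for this choice; the
    summand 1 keeps l positive when L = 0.\<close>
  define l where "l = 2 * L + 1"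
  have L0: "0 \<le> L" using L by (rule lipschitz_on_nonneg)
  then have l0: "0 < l" by (simp add: l_def)
  \<comment> \<open>Here \<open>v\<close> is the weighted unknown, exp(-l t) times the solution,
    which stays bounded; \<open>G\<close> evaluates the field at the unweighted one. In
    \<open>P\<close>, the term \<open>max 0 t\<close> extends the Picard map to the whole line, the
    domain of the bounded continuous functions.\<close>
  define G where "G v s = F (exp (l * s) *\<^sub>R apply_bcontfun v s)" for v :: "real \<Rightarrow>\<^sub>C 'a" and s
  define I where "I v t = u0 + integral {0..t} (G v)" for v :: "real \<Rightarrow>\<^sub>C 'a" and t
  define P where "P v t = exp (- (l * max 0 t)) *\<^sub>R I v (max 0 t)" for v :: "real \<Rightarrow>\<^sub>C 'a" and t
  have contF: "continuous_on S F" for S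
    using L lipschitz_on_continuous_on continuous_on_subset by blast
  have contG: "continuous_on S (G v)" for S v
    unfolding G_def by (intro continuous_on_compose2[OF contF[of UNIV]] continuous_intros) auto
  have dI: "(I v has_vector_derivative G v t) (at t within {0..})" if "0 \<le> t" for v t
  proof -
    \<comment> \<open>The right end point t+1 lies beyond t, so that the derivative relative to this
      compact interval is the one relative to the half line.\<close>
    have "((\<lambda>r. integral {0..r} (G v)) has_vector_derivative G v t) (at t within {0..t+1})"
      using that by (intro integral_has_vector_derivative contG) auto
    then show ?thesis
      unfolding I_def at_within_Icc_eq_Ici[OF that] by (auto intro!: derivative_eq_intros)
  qed
  have contI: "continuous_on {0..} (I v)" for v
    using dI by (auto simp: continuous_on_eq_continuous_within intro: has_vector_derivative_continuous)
  have Fle: "norm (F x) \<le> norm (F 0) + L * norm x" for x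
    using lipschitz_onD[OF L, of x 0] norm_triangle_sub[of "F x" "F 0"] by (simp add: dist_norm)
  have P: "P v \<in> bcontfun" for v
  proof (rule bcontfun_normI)
    have "continuous_on UNIV (\<lambda>t. I v (max 0 t))"
      by (rule continuous_on_compose2[OF contI]) (auto intro!: continuous_intros)
    then show "continuous_on UNIV (P v)"
      unfolding P_def by (intro continuous_intros)
  next
    fix r :: real
    define t where "t = max 0 r"
    have t: "0 \<le> t" by (simp add: t_def)
    define C where "C = norm (F 0) + L * norm v"
    have C: "0 \<le> C" using L0 by (simp add: C_def)
    have "norm (G v s) \<le> C * exp (l * s)" if "0 \<le> s" for s
    proof -
      have "norm (G v s) \<le> norm (F 0) * 1 + L * (exp (l * s) * norm (apply_bcontfun v s))"
        unfolding G_def using Fle[of "exp (l * s) *\<^sub>R apply_bcontfun v s"] by simp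
      also have "\<dots> \<le> norm (F 0) * exp (l * s) + L * (exp (l * s) * norm v)"
        using that L0 l0 by (intro add_mono mult_left_mono norm_bounded) auto
      finally show ?thesis by (simp add: C_def algebra_simps)
    qed
    then have "norm (integral {0..t} (G v)) \<le> C * exp (l * t) / l"
      using t l0 C contG by (intro norm_integral_le_exp) auto
    then have "norm (I v t) \<le> norm u0 + C * exp (l * t) / l"
      unfolding I_def by (intro order_trans[OF norm_triangle_ineq]) auto
    then have "norm (P v r) \<le> exp (- (l * t)) * (norm u0 + C * exp (l * t) / l)"
      unfolding P_def t_def[symmetric] by simp
    also have "\<dots> = exp (- (l * t)) * norm u0 + C / l"
      by (simp add: algebra_simps exp_minus)
    also have "\<dots> \<le> 1 * norm u0 + C / l"
      using t l0 by (intro add_mono mult_right_mono) auto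
    finally show "norm (P v r) \<le> 1 * norm u0 + C / l" .
  qed
  have "\<exists>!v. Bcontfun (P v) = v"
  proof (rule banach_fix_type[where c = "1/2"])
    show "\<forall>v w. dist (Bcontfun (P v)) (Bcontfun (P w)) \<le> 1 / 2 * dist v w"
    proof (intro allI dist_bound)
      fix v w :: "real \<Rightarrow>\<^sub>C 'a" and r :: real
      define t where "t = max 0 r"
      have t: "0 \<le> t" by (simp add: t_def)
      define C where "C = L * dist v w"
      have C: "0 \<le> C" using L0 by (simp add: C_def)
      have "norm (G v s - G w s) \<le> C * exp (l * s)" for s
      proof -
        have "norm (G v s - G w s) \<le> L * norm (exp (l * s) *\<^sub>R apply_bcontfun v s - exp (l * s) *\<^sub>R apply_bcontfun w s)"
          unfolding G_def using lipschitz_onD[OF L] by (simp add: dist_norm)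
        also have "\<dots> = L * (exp (l * s) * dist (apply_bcontfun v s) (apply_bcontfun w s))"
          by (simp add: dist_norm scaleR_diff_right[symmetric])
        also have "\<dots> \<le> L * (exp (l * s) * dist v w)"
          using L0 by (intro mult_left_mono dist_bounded) auto
        finally show ?thesis by (simp add: C_def algebra_simps)
      qed
      then have "norm (integral {0..t} (\<lambda>s. G v s - G w s)) \<le> C * exp (l * t) / l"
        using t l0 C contG by (intro norm_integral_le_exp continuous_intros) auto
      also have "integral {0..t} (\<lambda>s. G v s - G w s) = I v t - I w t"
        unfolding I_def by (simp add: integral_diff integrable_continuous_real contG)
      finally have "norm (I v t - I w t) \<le> C * exp (l * t) / l" .
      from mult_left_mono[OF this, of "exp (- (l * t))"]
      have "dist (P v r) (P w r) \<le> exp (- (l * t)) * (C * exp (l * t) / l)"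
        unfolding P_def t_def[symmetric] by (simp add: dist_norm scaleR_diff_right[symmetric])
      also have "\<dots> = L / l * dist v w"
        by (simp add: exp_minus C_def)
      also have "\<dots> \<le> 1 / 2 * dist v w"
        using l0 by (intro mult_right_mono) (auto simp: l_def field_simps)
      finally show "dist (apply_bcontfun (Bcontfun (P v)) r) (apply_bcontfun (Bcontfun (P w)) r) \<le> 1 / 2 * dist v w"
        using P by (simp add: Bcontfun_inverse)
    qed
  qed auto
  then obtain v where "Bcontfun (P v) = v" by blast
  then have v: "apply_bcontfun v t = P v t" for t
    using P by (metis Bcontfun_inverse)
  show ?thesis
  proof
    \<comment> \<open>The solution is the integral \<open>I v\<close>. At the fixed point, for
      nonnegative t, it is exp(l t) times \<open>v\<close>, so that \<open>G v t\<close> is the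
      field along it.\<close>
    show "I v 0 = u0" by (simp add: I_def)
    show "(I v has_vector_derivative F (I v t)) (at t within {0..})" if "0 \<le> t" for t
    proof -
      have "G v t = F (I v t)"
        unfolding G_def v P_def using that by (simp add: exp_minus)
      then show ?thesis using dI[OF that] by metis
    qed
  qed
qed

section \<open>Radial clipping and conservative quadratic systems\<close>

definition radial_clip :: "real \<Rightarrow> 'a::real_normed_vector \<Rightarrow> 'a" where
  "radial_clip R x = (if norm x \<le> R then x else (R / norm x) *\<^sub>R x)"

lemma norm_radial_clip_le: "0 \<le> R \<Longrightarrow> norm (radial_clip R x) \<le> R"
  by (auto simp: radial_clip_def)

text \<open>In a Hilbert space this retraction onto the ball is nonexpansive; for a general norm the
  change of the scaling factor costs a second \<open>norm (x - y)\<close>, hence the constant 2. The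
  displacement is split into a move at fixed scale and a change of scale along
  \<open>y\<close>.\<close>

lemma lipschitz_on_radial_clip:
  assumes "0 < R"
  shows "2-lipschitz_on UNIV (radial_clip R :: 'a::real_normed_vector \<Rightarrow> 'a)"
proof (rule lipschitz_onI)
  have *: "norm (radial_clip R x - radial_clip R y) \<le> 2 * norm (x - y)" if "norm x \<le> norm y"
    for x y :: 'a
  proof -
    have yx: "norm y - norm x \<le> norm (x - y)"
      by (metis norm_minus_commute norm_triangle_ineq2)
    consider "norm y \<le> R" | "norm x \<le> R" "R < norm y" | "R < norm x" using that by linarith
    then show ?thesis
    proof cases
      case 1
      then show ?thesis using that by (simp add: radial_clip_def)
    next
      case 2
      then have y0: "0 < norm y" using assms by linarith
      have "x - (R / norm y) *\<^sub>R y = (x - y) + (1 - R / norm y) *\<^sub>R y"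
        by (simp add: algebra_simps)
      then have "norm (x - (R / norm y) *\<^sub>R y) \<le> norm (x - y) + norm ((1 - R / norm y) *\<^sub>R y)"
        by (metis norm_triangle_ineq)
      also have "norm ((1 - R / norm y) *\<^sub>R y) = norm y - R"
        using 2 y0 by (simp add: field_simps)
      finally show ?thesis using 2 yx by (simp add: radial_clip_def)
    next
      case 3
      then have x0: "0 < norm x" and y0: "0 < norm y" using assms that by linarith+
      have eq: "(R / norm x) *\<^sub>R x - (R / norm y) *\<^sub>R y
          = (R / norm x) *\<^sub>R (x - y) + (R / norm x - R / norm y) *\<^sub>R y"
        by (simp add: algebra_simps)
      have "R / norm x - R / norm y \<ge> 0"
        using that x0 assms by (simp add: frac_le)
      then have n: "norm ((R / norm x - R / norm y) *\<^sub>R y) = R / norm x * (norm y - norm x)"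
        using x0 y0 by (simp add: field_simps)
      have "norm ((R / norm x) *\<^sub>R x - (R / norm y) *\<^sub>R y)
          \<le> R / norm x * norm (x - y) + R / norm x * (norm y - norm x)"
        unfolding eq n[symmetric] by (rule order_trans[OF norm_triangle_ineq]) (use assms in simp)
      also have "\<dots> \<le> R / norm x * (2 * norm (x - y))"
        unfolding distrib_left[symmetric] using yx assms x0 by (intro mult_left_mono) auto
      also have "\<dots> \<le> 1 * (2 * norm (x - y))"
        using 3 x0 by (intro mult_right_mono) auto
      finally show ?thesis using 3 that by (simp add: radial_clip_def)
    qed
  qed
  fix x y :: 'a
  show "dist (radial_clip R x) (radial_clip R y) \<le> 2 * dist x y"
    using *[of x y] *[of y x] by (cases "norm x \<le> norm y") (auto simp: dist_norm norm_minus_commute)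
qed simp

instance bcontfun :: (metric_space, banach) banach ..

text \<open>The bounded sequences, as bounded continuous functions on a discrete space, serve as state space, since the number \<open>M\<close> of
  unknowns is not a type. Rescaling the argument of \<open>F\<close> to bounded norm gives a
  globally Lipschitz field that still conserves \<open>\<Sum>j<M. (a j)\<^sup>2\<close>; by that conservation, the
  rescaling is never active along the solution.\<close>

lemma conservative_quadratic_ode_global_solution:
  fixes Q :: "nat \<Rightarrow> nat \<Rightarrow> nat \<Rightarrow> real" and K :: "nat \<Rightarrow> nat \<Rightarrow> real" and M :: nat
  defines "F \<equiv> \<lambda>c j. (\<Sum>i<M. \<Sum>k<M. Q j i k * (c i * c k)) + (\<Sum>i<M. K j i * c i)"
  assumes cons: "\<And>c. (\<Sum>j<M. c j * F c j) = 0"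
  obtains a where "\<And>j. j < M \<Longrightarrow> a j 0 = a0 j"
    and "\<And>j t. j < M \<Longrightarrow> 0 \<le> t \<Longrightarrow>
      (a j has_real_derivative F (\<lambda>i. a i t) j) (at t within {0..})"
proof -
  \<comment> \<open>\<open>V\<close> reads coordinates and \<open>W\<close> embeds M of them,
    padding with zeros. The field \<open>E\<close> vanishes in the padding coordinates.\<close>
  define V where "V c i = apply_bcontfun c (discrete i)" for c :: "nat discrete \<Rightarrow>\<^sub>C real" and i
  define W where "W h = Bcontfun (\<lambda>d. if of_discrete d < M then h (of_discrete d) else 0)" for h :: "nat \<Rightarrow> real"
  define E where "E c = W (F (V c))" for c
  have fin: "(\<lambda>d. if of_discrete d < M then h (of_discrete d) else 0) \<in> bcontfun" for h :: "nat \<Rightarrow> real"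
  proof (rule bcontfun_normI)
    show "norm (if of_discrete d < M then h (of_discrete d) else 0) \<le> (\<Sum>j<M. \<bar>h j\<bar>)" for d
      using member_le_sum[of "of_discrete d" "{..<M}" "\<lambda>j. \<bar>h j\<bar>"] by (auto simp: sum_nonneg)
  qed (simp add: continuous_on_open_vimage open_discrete)
  have VW: "V (W h) j = (if j < M then h j else 0)" for h j
    unfolding V_def W_def by (subst Bcontfun_inverse) (use fin in \<open>auto simp: discrete_inverse\<close>)
  have E: "V (E c) j = (if j < M then F (V c) j else 0)" for c j
    unfolding E_def by (rule VW)
  have discreteE: "\<exists>j. d = discrete j" for d :: "nat discrete"
    by (metis of_discrete_inverse)
  \<comment> \<open>One more than the Euclidean norm of the initial data, so that R is positive for
    zero data too.\<close>
  define R where "R = sqrt (\<Sum>j<M. (a0 j)\<^sup>2) + 1"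
  have R: "0 < R" unfolding R_def by (smt (verit) real_sqrt_ge_0_iff sum_nonneg zero_le_power2)
  \<comment> \<open>On the ball of radius R in the sup norm, a product of two coordinates has
    Lipschitz constant 2R. Thus \<open>B j\<close> serves for component j, and the sum over j bounds
    every component at once.\<close>
  define B where "B j = (\<Sum>i<M. \<Sum>k<M. \<bar>Q j i k\<bar> * (2 * R)) + (\<Sum>i<M. \<bar>K j i\<bar>)" for j
  have B0: "0 \<le> B j" for j unfolding B_def using R by (intro add_nonneg_nonneg sum_nonneg) auto
  have lip: "(\<Sum>j<M. B j)-lipschitz_on (cball 0 R) E"
  proof (rule lipschitz_onI)
    fix c d :: "nat discrete \<Rightarrow>\<^sub>C real"
    assume "c \<in> cball 0 R" "d \<in> cball 0 R"
    then have cd: "norm c \<le> R" "norm d \<le> R" by auto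
    have c: "\<bar>V c i\<bar> \<le> R" and d: "\<bar>V d i\<bar> \<le> R" for i
      using norm_bounded[of c "discrete i"] norm_bounded[of d "discrete i"] cd by (auto simp: V_def)
    have dif: "\<bar>V c i - V d i\<bar> \<le> dist c d" for i
      using dist_bounded[of c "discrete i" d] by (simp add: dist_norm V_def)
    show "dist (E c) (E d) \<le> (\<Sum>j<M. B j) * dist c d"
    proof (rule dist_bound)
      fix z :: "nat discrete"
      obtain j where z: "z = discrete j" using discreteE by blast
      have "dist (V (E c) j) (V (E d) j) \<le> (\<Sum>j<M. B j) * dist c d"
      proof (cases "j < M")
        case True
        let ?c = "V c" and ?d = "V d"
        have prod: "\<bar>Q j i k * (?c i * ?c k) - Q j i k * (?d i * ?d k)\<bar> \<le> \<bar>Q j i k\<bar> * (2 * R) * dist c d" for i k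
        proof -
          have "?c i * ?c k - ?d i * ?d k = ?c i * (?c k - ?d k) + (?c i - ?d i) * ?d k"
            by (simp add: algebra_simps)
          then have "\<bar>?c i * ?c k - ?d i * ?d k\<bar> \<le> \<bar>?c i\<bar> * \<bar>?c k - ?d k\<bar> + \<bar>?c i - ?d i\<bar> * \<bar>?d k\<bar>"
            by (metis abs_mult abs_triangle_ineq)
          also have "\<dots> \<le> R * dist c d + dist c d * R"
            using c d dif R by (intro add_mono mult_mono) auto
          finally have "\<bar>?c i * ?c k - ?d i * ?d k\<bar> \<le> 2 * R * dist c d" by simp
          then show ?thesis
            by (simp add: right_diff_distrib[symmetric] abs_mult mult.assoc mult_left_mono)
        qed
        have lin: "\<bar>K j i * ?c i - K j i * ?d i\<bar> \<le> \<bar>K j i\<bar> * dist c d" for i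
          unfolding right_diff_distrib[symmetric] abs_mult by (intro mult_left_mono dif) simp
        have dF: "F ?c j - F ?d j = (\<Sum>i<M. \<Sum>k<M. Q j i k * (?c i * ?c k) - Q j i k * (?d i * ?d k))
            + (\<Sum>i<M. K j i * ?c i - K j i * ?d i)"
          unfolding F_def sum_subtractf by linarith
        have "\<bar>F ?c j - F ?d j\<bar> \<le> (\<Sum>i<M. \<Sum>k<M. \<bar>Q j i k\<bar> * (2 * R) * dist c d) + (\<Sum>i<M. \<bar>K j i\<bar> * dist c d)"
          unfolding dF by (rule order_trans[OF abs_triangle_ineq], rule add_mono)
            (use prod lin in \<open>auto intro!: sum_norm_le[where 'a = real, unfolded real_norm_def]\<close>)
        also have "\<dots> = B j * dist c d"
          by (simp only: B_def distrib_right sum_distrib_right)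
        also have "\<dots> \<le> (\<Sum>j<M. B j) * dist c d"
          using True B0 by (intro mult_right_mono member_le_sum) auto
        finally show ?thesis using True by (simp add: E dist_norm)
      next
        case False
        then show ?thesis using B0 by (simp add: E sum_nonneg)
      qed
      then show "dist (apply_bcontfun (E c) z) (apply_bcontfun (E d) z) \<le> (\<Sum>j<M. B j) * dist c d"
        by (simp add: V_def z)
    qed
  qed (use B0 in \<open>simp add: sum_nonneg\<close>)
  have "((\<Sum>j<M. B j) * 2)-lipschitz_on UNIV (E \<circ> radial_clip R)"
    using R norm_radial_clip_le[of R]
    by (intro lipschitz_on_compose lipschitz_on_radial_clip lipschitz_on_subset[OF lip]) auto
  from lipschitz_ode_global_solution[OF this, of "W a0"]
  obtain u where u0: "u 0 = W a0"
    and du: "\<And>t. 0 \<le> t \<Longrightarrow> (u has_vector_derivative E (radial_clip R (u t))) (at t within {0..})"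
    by (auto simp: o_def)
  define a where "a j t = V (u t) j" for j t
  define \<sigma> where "\<sigma> t = (if norm (u t) \<le> R then 1 else R / norm (u t))" for t
  have \<sigma>: "0 < \<sigma> t" for t using R by (auto simp: \<sigma>_def intro!: divide_pos_pos)
  have clip: "radial_clip R (u t) = \<sigma> t *\<^sub>R u t" for t
    by (simp add: radial_clip_def \<sigma>_def)
  have bl: "bounded_linear (\<lambda>c. V c j)" for j
    unfolding V_def
    by (rule bounded_linear_intro[where K = 1]) (simp_all flip: real_norm_def add: norm_bounded)
  have V_scale: "V (r *\<^sub>R c) = (\<lambda>i. r * V c i)" for r c
    by (simp add: V_def fun_eq_iff)
  have da: "(a j has_real_derivative (if j < M then F (\<lambda>i. \<sigma> t * a i t) j else 0)) (at t within {0..})"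
    if "0 \<le> t" for j t
  proof -
    have "(a j has_vector_derivative V (E (radial_clip R (u t))) j) (at t within {0..})"
      unfolding a_def by (rule bounded_linear.has_vector_derivative[OF bl du[OF that]])
    then show ?thesis
      by (simp add: has_real_derivative_iff_has_vector_derivative E clip V_scale a_def[abs_def] cong: if_cong)
  qed
  have a00: "a j 0 = (if j < M then a0 j else 0)" for j
    unfolding a_def u0 by (rule VW)
  define e where "e t = (\<Sum>j<M. (a j t)\<^sup>2)" for t
  have "(e has_real_derivative 0) (at t within {0..})" if t: "0 \<le> t" for t
  proof -
    have "(e has_real_derivative (\<Sum>j<M. 2 * (a j t * F (\<lambda>i. \<sigma> t * a i t) j))) (at t within {0..})"
      unfolding e_def
    proof (rule DERIV_sum)
      fix j assume "j \<in> {..<M}"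
      then show "((\<lambda>t. (a j t)\<^sup>2) has_real_derivative 2 * (a j t * F (\<lambda>i. \<sigma> t * a i t) j)) (at t within {0..})"
        using DERIV_power[OF da[OF t, of j], of 2] by (simp add: mult_ac)
    qed
    \<comment> \<open>The conservation hypothesis at the rescaled state carries an extra factor
      \<sigma>, which can be cancelled because it is positive.\<close>
    moreover have "\<sigma> t * (\<Sum>j<M. a j t * F (\<lambda>i. \<sigma> t * a i t) j) = 0"
      using cons[of "\<lambda>i. \<sigma> t * a i t"] by (simp add: sum_distrib_left mult.assoc)
    then have "(\<Sum>j<M. 2 * (a j t * F (\<lambda>i. \<sigma> t * a i t) j)) = 0"
      using \<sigma>[of t] by (simp add: sum_distrib_left[symmetric])
    ultimately show ?thesis by simp
  qed
  then obtain C where C: "\<And>t. t \<in> {0..} \<Longrightarrow> e t = C"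
    using has_field_derivative_zero_constant[of "{0..}" e] by (auto simp: convex_real_interval)
  then have e: "e t = (\<Sum>j<M. (a0 j)\<^sup>2)" if "0 \<le> t" for t
  proof -
    have "e 0 = (\<Sum>j<M. (a0 j)\<^sup>2)" by (simp add: e_def a00)
    then show ?thesis using C[of 0] C[of t] that by simp
  qed
  have "\<sigma> t = 1" if t: "0 \<le> t" for t
  proof -
    \<comment> \<open>The sup norm is at most the Euclidean norm, which is conserved. The padding
      coordinates are constant and start at zero.\<close>
    have "norm (u t) \<le> R"
    proof (rule norm_bound)
      fix z :: "nat discrete"
      obtain j where z: "z = discrete j" using discreteE by blast
      have "\<bar>a j t\<bar> \<le> R"
      proof (cases "j < M")
        case True
        then have "(a j t)\<^sup>2 \<le> e t"
          unfolding e_def by (intro member_le_sum) auto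
        then have "\<bar>a j t\<bar> \<le> sqrt (e t)"
          using real_le_rsqrt[of "\<bar>a j t\<bar>"] by simp
        then show ?thesis using e[OF t] by (simp add: R_def)
      next
        case False
        then have "(a j has_real_derivative 0) (at s within {0..})" if "0 \<le> s" for s
          using da[OF that, of j] by simp
        then obtain C where "\<And>s. s \<in> {0..} \<Longrightarrow> a j s = C"
          using has_field_derivative_zero_constant[of "{0..}" "a j"] by (auto simp: convex_real_interval)
        then have "a j t = 0" using a00[of j] False t by (metis atLeast_iff order_refl)
        then show ?thesis using R by simp
      qed
      then show "norm (apply_bcontfun (u t) z) \<le> R" by (simp add: a_def V_def z)
    qed
    then show ?thesis by (simp add: \<sigma>_def)
  qed
  then have "(a j has_real_derivative F (\<lambda>i. a i t) j) (at t within {0..})" if "j < M" "0 \<le> t" for j t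
    using da[OF that(2), of j] that by simp
  then show ?thesis
    using that[of a] a00 by simp
qed

subsection \<open>Trigonometric polynomials\<close>

definition wave :: "int \<Rightarrow> real \<Rightarrow> complex" where
  "wave k x = exp (\<i> * of_int k * complex_of_real x)"

lemma trig_space_wave:
  "trig_space N = {f. \<exists>c. f = (\<lambda>x. \<Sum>k\<in>{- int N..int N}. c k * wave k x)}"
  unfolding trig_space_def wave_def ..

lemma wave_cis: "wave k x = cis (of_int k * x)"
  by (simp add: wave_def cis_conv_exp mult.assoc)

lemma wave_0 [simp]: "wave 0 x = 1"
  by (simp add: wave_cis)

lemma wave_add: "wave (k + l) x = wave k x * wave l x"
  by (simp add: wave_cis cis_mult distrib_right)

lemma wave_add_right: "wave k (x + y) = wave k x * wave k y"
  by (simp add: wave_cis cis_mult distrib_left)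

lemma wave_diff_right: "wave k (x - y) = wave k x * wave (- k) y"
  by (simp add: wave_cis cis_mult right_diff_distrib)

lemma wave_power: "wave k (of_nat n * x) = wave k x ^ n"
  by (simp add: wave_cis Complex.DeMoivre mult.left_commute)

lemma wave_2pi: "wave k (2 * pi) = 1"
  by (simp only: wave_cis mult.commute[of _ "2 * pi"]) (simp add: cis_multiple_2pi)

lemma wave_pi: "wave k (- pi) = wave k pi"
  using wave_add_right[of k "- pi" "2 * pi"] by (simp add: wave_2pi)

lemma wave_has_vector_derivative:
  "(wave k has_vector_derivative \<i> * of_int k * wave k x) (at x within S)"
proof -
  have "((\<lambda>z. exp (\<i> * of_int k * z)) has_field_derivative \<i> * of_int k * wave k x) (at (complex_of_real x))"
    unfolding wave_def by (auto intro!: derivative_eq_intros)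
  from has_vector_derivative_real_field[OF this]
  show ?thesis unfolding wave_def[abs_def] .
qed

lemma continuous_on_wave [continuous_intros]: "continuous_on S (wave k)"
  unfolding wave_def[abs_def] by (intro continuous_intros)

text \<open>The only form of integration by parts used below: the boundary terms of a periodic
  potential cancel.\<close>

lemma integral_period_derivative:
  fixes g :: "real \<Rightarrow> 'b::euclidean_space"
  assumes "\<And>x. (g has_vector_derivative g' x) (at x)"
    and "continuous_on {-pi..pi} g'" and "g (- pi) = g pi"
  shows "(LINT x|period_measure. g' x) = 0"
proof -
  have "(g' has_integral (g pi - g (- pi))) {-pi..pi}"
    using assms(1) by (intro fundamental_theorem_of_calculus)
      (auto intro: has_vector_derivative_at_within order_trans[of _ 0])
  then show ?thesis
    using assms by (simp add: lebesgue_integral_eq_integral continuous_imp_integrable_real integral_unique)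
qed

lemma integral_wave: "(LINT x|period_measure. wave k x) = (if k = 0 then 2 * pi else 0)"
proof (cases "k = 0")
  case True
  have "(LINT x|period_measure. (1::complex)) = integral {-pi..pi} (\<lambda>x. 1)"
    by (rule lebesgue_integral_eq_integral) auto
  then show ?thesis using True by (simp add: scaleR_conv_of_real del: Bochner_Integration.lebesgue_integral_const)
next
  case False
  have "(LINT x|period_measure. wave k x) = 0"
  proof (rule integral_period_derivative)
    show "((\<lambda>x. wave k x / (\<i> * of_int k)) has_vector_derivative wave k x) (at x)" for x
      using False has_vector_derivative_mult_left[OF wave_has_vector_derivative[of k x UNIV], of "1 / (\<i> * of_int k)"]
      by simp
  qed (auto intro: continuous_intros simp: wave_pi)
  then show ?thesis using False by simp
qed

section \<open>Equispaced nodes and the nodal basis\<close>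

definition node :: "nat \<Rightarrow> nat \<Rightarrow> real" where
  "node N j = of_nat j * (2 * pi / (2 * N + 1))"

text \<open>Written with cosines to be real by definition, and normalised to the value 1 at its own
  node.\<close>

definition nodal :: "nat \<Rightarrow> nat \<Rightarrow> real \<Rightarrow> real" where
  "nodal N j x = (\<Sum>k\<in>{- int N..int N}. cos (of_int k * (x - node N j))) / (2 * N + 1)"

text \<open>The sines in the exponential form cancel in pairs k and -k.\<close>

lemma of_real_nodal:
  "complex_of_real (nodal N j x) = (\<Sum>k\<in>{- int N..int N}. wave (- k) (node N j) * wave k x) / (2 * N + 1)"
proof -
  define y where "y = x - node N j"
  have "(\<Sum>k\<in>{- int N..int N}. sin (of_int k * y)) = (\<Sum>k\<in>{- int N..int N}. - sin (of_int k * y))"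
    by (rule sum.reindex_bij_witness[where i = uminus and j = uminus]) auto
  then have "(\<Sum>k\<in>{- int N..int N}. sin (of_int k * y)) = 0"
    by (simp add: sum_negf)
  then have "(\<Sum>k\<in>{- int N..int N}. wave k y) = of_real (\<Sum>k\<in>{- int N..int N}. cos (of_int k * y))"
    by (intro complex_eqI) (simp_all add: wave_cis)
  then show ?thesis
    by (simp add: nodal_def y_def wave_diff_right mult.commute)
qed

lemma not_dvd_int_if_less: "m \<noteq> 0 \<Longrightarrow> \<bar>m\<bar> < n \<Longrightarrow> \<not> n dvd m" for m n :: int
  using dvd_imp_le_int[of m n] by auto

text \<open>A geometric sum over the powers of a root of unity of order dividing 2N+1; the
  divisibility assumption says that this root is not 1.\<close>

lemma sum_wave_node:
  assumes "\<not> (2 * int N + 1) dvd m"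
  shows "(\<Sum>j\<le>2*N. wave m (node N j)) = 0"
proof -
  define z where "z = wave m (2 * pi / (2 * N + 1))"
  have "z \<noteq> 1"
  proof
    assume "z = 1"
    then obtain n :: int where "of_int m * (2 * pi / (2 * N + 1)) = of_int (2 * n) * pi"
      unfolding z_def wave_def exp_eq_1 by (auto simp: mult.assoc)
    then have "pi * real_of_int m = pi * of_int (n * (2 * int N + 1))"
      by (simp add: field_simps)
    then have "real_of_int m = of_int (n * (2 * int N + 1))"
      by simp
    then have "m = n * (2 * int N + 1)"
      by (simp only: of_int_eq_iff)
    then show False using assms by simp
  qed
  have "z ^ Suc (2 * N) = wave m (of_nat (Suc (2 * N)) * (2 * pi / (2 * N + 1)))"
    unfolding z_def wave_power ..
  also have "\<dots> = 1"
  proof -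
    have "of_nat (Suc (2 * N)) * (2 * pi / (2 * N + 1)) = 2 * pi" by (simp add: field_simps)
    then show ?thesis by (simp only: wave_2pi)
  qed
  finally have "(\<Sum>j\<le>2*N. z ^ j) = 0"
    using geometric_sum[OF \<open>z \<noteq> 1\<close>, of "Suc (2 * N)"] by (simp only: lessThan_Suc_atMost) simp
  then show ?thesis
    unfolding node_def wave_power z_def .
qed

text \<open>Two frequencies in the range differ by at most 2N in absolute value, so distinct ones
  are never congruent modulo 2N+1. This is why 2N+1 nodes see no aliasing within the space.\<close>

lemma sum_wave_node_diff:
  assumes "k \<in> {- int N..int N}" "l \<in> {- int N..int N}"
  shows "(\<Sum>j\<le>2*N. wave k (node N j) * wave (- l) (node N j)) = (if k = l then 2 * N + 1 else 0)"
proof -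
  have "(\<Sum>j\<le>2*N. wave (k + - l) (node N j)) = 0" if "k \<noteq> l"
    using that assms by (intro sum_wave_node not_dvd_int_if_less) auto
  then show ?thesis
    by (cases "k = l") (simp_all add: wave_add[symmetric])
qed

text \<open>With both factors expanded in exponentials, summing over the nodes first leaves only the
  diagonal, by discrete orthogonality.\<close>

lemma trig_space_interpolation:
  assumes "\<phi> \<in> trig_space N"
  shows "\<phi> x = (\<Sum>j\<le>2*N. \<phi> (node N j) * nodal N j x)"
proof -
  obtain c where c: "\<phi> = (\<lambda>x. \<Sum>k\<in>{- int N..int N}. c k * wave k x)"
    using assms unfolding trig_space_wave by blast
  let ?K = "{- int N..int N}" and ?M = "2 * complex_of_nat N + 1"
  have M: "?M \<noteq> 0" by (metis of_nat_Suc of_nat_0_neq of_nat_mult of_nat_numeral add.commute plus_1_eq_Suc nat.distinct(1) of_nat_eq_0_iff)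
  have "(\<Sum>j\<le>2*N. \<phi> (node N j) * nodal N j x)
      = (\<Sum>j\<le>2*N. \<Sum>k\<in>?K. \<Sum>l\<in>?K. c k * wave l x / ?M * (wave k (node N j) * wave (- l) (node N j)))"
    unfolding c of_real_nodal by (simp add: sum_product sum_divide_distrib algebra_simps)
  also have "\<dots> = (\<Sum>k\<in>?K. \<Sum>l\<in>?K. c k * wave l x / ?M * (\<Sum>j\<le>2*N. wave k (node N j) * wave (- l) (node N j)))"
    unfolding sum_distrib_left by (subst sum.swap) (intro sum.cong refl sum.swap)
  also have "\<dots> = (\<Sum>k\<in>?K. \<Sum>l\<in>?K. if k = l then c k * wave l x else 0)"
    using M by (intro sum.cong refl) (auto simp: sum_wave_node_diff add.commute)
  also have "\<dots> = \<phi> x"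
    by (simp add: c)
  finally show ?thesis ..
qed

lemma nodal_node:
  assumes "i \<le> 2 * N" "j \<le> 2 * N"
  shows "nodal N i (node N j) = (if i = j then 1 else 0)"
proof (cases "i = j")
  case True
  then show ?thesis by (simp add: nodal_def)
next
  case False
  define m where "m = int j - int i"
  have "\<not> (2 * int N + 1) dvd m"
    using assms False by (intro not_dvd_int_if_less) (auto simp: m_def)
  have m: "of_int k * (node N j - node N i) = of_int m * (of_int k * (2 * pi / (2 * N + 1)))" for k :: int
    unfolding node_def m_def of_int_diff of_int_of_nat_eq
    by (simp only: left_diff_distrib right_diff_distrib mult_ac)
  \<comment> \<open>Frequencies and nodes exchange roles. After a shift by N, at the cost of one
    factor of modulus 1, the wave of frequency l at the offset between the nodes is the wave of
    frequency m at node l.\<close>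
  have "(\<Sum>k\<in>{- int N..int N}. wave k (node N j - node N i))
      = (\<Sum>l\<le>2*N. wave (int l - int N) (node N j - node N i))"
    by (rule sum.reindex_bij_witness[where i = "\<lambda>l. int l - int N" and j = "\<lambda>k. nat (k + int N)"]) auto
  also have "\<dots> = wave (- int N) (node N j - node N i) * (\<Sum>l\<le>2*N. wave (int l) (node N j - node N i))"
    unfolding sum_distrib_left wave_add[symmetric] by simp
  also have "(\<Sum>l\<le>2*N. wave (int l) (node N j - node N i)) = (\<Sum>l\<le>2*N. wave m (node N l))"
    unfolding wave_cis m by (simp add: node_def mult.assoc)
  also have "\<dots> = 0"
    by (rule sum_wave_node) fact
  finally have "complex_of_real (nodal N i (node N j)) = 0"
    unfolding of_real_nodal by (simp add: wave_diff_right mult.commute)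
  then show ?thesis using False by simp
qed

lemma trig_spaceI: "(\<lambda>x. \<Sum>k\<in>{- int N..int N}. c k * wave k x) \<in> trig_space N"
  unfolding trig_space_wave by (rule CollectI, rule exI, rule refl)

lemma trig_space_add:
  assumes "f \<in> trig_space N" "g \<in> trig_space N"
  shows "(\<lambda>x. f x + g x) \<in> trig_space N"
proof -
  obtain c d where "f = (\<lambda>x. \<Sum>k\<in>{- int N..int N}. c k * wave k x)"
    "g = (\<lambda>x. \<Sum>k\<in>{- int N..int N}. d k * wave k x)"
    using assms unfolding trig_space_wave by blast
  then show ?thesis
    unfolding trig_space_wave
    by (auto intro!: exI[of _ "\<lambda>k. c k + d k"] simp: distrib_right sum.distrib)
qed

lemma trig_space_scale:
  assumes "f \<in> trig_space N"
  shows "(\<lambda>x. a * f x) \<in> trig_space N"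
proof -
  obtain c where "f = (\<lambda>x. \<Sum>k\<in>{- int N..int N}. c k * wave k x)"
    using assms unfolding trig_space_wave by blast
  then show ?thesis
    unfolding trig_space_wave
    by (auto intro!: exI[of _ "\<lambda>k. a * c k"] simp: sum_distrib_left mult.assoc)
qed

lemma trig_space_sum:
  assumes "finite J" "\<And>j. j \<in> J \<Longrightarrow> f j \<in> trig_space N"
  shows "(\<lambda>x. \<Sum>j\<in>J. f j x) \<in> trig_space N"
  using assms
proof (induction J)
  case empty
  then show ?case
    unfolding trig_space_wave by (auto intro!: exI[of _ "\<lambda>k. 0"])
next
  case (insert j J)
  then show ?case using trig_space_add[of "f j" N "\<lambda>x. \<Sum>j\<in>J. f j x"] by simp
qed

lemma continuous_on_trig_space: "f \<in> trig_space N \<Longrightarrow> continuous_on S f"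
  unfolding trig_space_wave by (auto intro!: continuous_intros)

lemma trig_space_periodic:
  assumes "f \<in> trig_space N"
  shows "f (x + 2 * pi) = f x"
  using assms unfolding trig_space_wave by (auto simp: wave_add_right wave_2pi)

lemma trig_space_has_derivative:
  assumes "f \<in> trig_space N"
  obtains g where "g \<in> trig_space N" "\<And>x. (f has_vector_derivative g x) (at x)"
proof -
  obtain c where c: "f = (\<lambda>x. \<Sum>k\<in>{- int N..int N}. c k * wave k x)"
    using assms unfolding trig_space_wave by blast
  show ?thesis
  proof
    show "(\<lambda>x. \<Sum>k\<in>{- int N..int N}. c k * (\<i> * of_int k) * wave k x) \<in> trig_space N"
      by (rule trig_spaceI)
    show "(f has_vector_derivative (\<Sum>k\<in>{- int N..int N}. c k * (\<i> * of_int k) * wave k x)) (at x)" for x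
      unfolding c mult.assoc
      by (intro has_vector_derivative_sum has_vector_derivative_mult_right wave_has_vector_derivative[unfolded mult.assoc])
  qed
qed

text \<open>Up to the weight, the nodal function is the reproducing kernel of the space at its node:
  only the frequencies k and -k pair, and each mode returns its own value there.\<close>

lemma integral_trig_space_nodal:
  fixes u :: "real \<Rightarrow> complex"
  assumes "u \<in> trig_space N"
  shows "(LINT x|period_measure. u x * of_real (nodal N j x)) = 2 * pi / (2 * N + 1) * u (node N j)"
proof -
  let ?K = "{- int N..int N}" and ?M = "complex_of_real (2 * N + 1)"
  obtain c where c: "u = (\<lambda>x. \<Sum>k\<in>?K. c k * wave k x)"
    using assms unfolding trig_space_wave by blast
  have "u x * of_real (nodal N j x)
      = (\<Sum>k\<in>?K. \<Sum>l\<in>?K. c k * wave (- l) (node N j) / ?M * wave (k + l) x)" for x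
    unfolding c of_real_nodal wave_add by (simp add: sum_product sum_divide_distrib mult_ac)
  then have "(LINT x|period_measure. u x * of_real (nodal N j x))
      = (\<Sum>k\<in>?K. \<Sum>l\<in>?K. c k * wave (- l) (node N j) / ?M * (LINT x|period_measure. wave (k + l) x))"
    by (simp add: Bochner_Integration.integral_sum continuous_imp_integrable_real continuous_intros)
  also have "\<dots> = (\<Sum>k\<in>?K. \<Sum>l\<in>?K. if l = - k then 2 * pi / ?M * (c k * wave k (node N j)) else 0)"
    by (intro sum.cong refl) (auto simp: integral_wave add_eq_0_iff)
  also have "\<dots> = (\<Sum>k\<in>?K. 2 * pi / ?M * (c k * wave k (node N j)))"
    by (intro sum.cong refl) auto
  finally show ?thesis by (simp add: c sum_distrib_left add.commute)
qed

section \<open>Real-valued trigonometric polynomials\<close>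

lemma real_trig_space_iff: "u \<in> real_trig_space N \<longleftrightarrow> (\<lambda>x. complex_of_real (u x)) \<in> trig_space N"
  by (simp add: real_trig_space_def)

lemma real_trig_space_add:
  "u \<in> real_trig_space N \<Longrightarrow> v \<in> real_trig_space N \<Longrightarrow> (\<lambda>x. u x + v x) \<in> real_trig_space N"
  unfolding real_trig_space_iff of_real_add by (rule trig_space_add)

lemma real_trig_space_scale:
  "u \<in> real_trig_space N \<Longrightarrow> (\<lambda>x. a * u x) \<in> real_trig_space N"
  unfolding real_trig_space_iff of_real_mult by (rule trig_space_scale)

lemma real_trig_space_diff:
  "u \<in> real_trig_space N \<Longrightarrow> v \<in> real_trig_space N \<Longrightarrow> (\<lambda>x. u x - v x) \<in> real_trig_space N"
  using real_trig_space_add[OF _ real_trig_space_scale[of v N "-1"], of u] by simp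

lemma real_trig_space_sum:
  "finite J \<Longrightarrow> (\<And>j. j \<in> J \<Longrightarrow> b j \<in> real_trig_space N) \<Longrightarrow> (\<lambda>x. \<Sum>j\<in>J. a j * b j x) \<in> real_trig_space N"
  unfolding real_trig_space_iff of_real_sum of_real_mult by (intro trig_space_sum trig_space_scale)

lemma nodal_in_real_trig_space: "nodal N j \<in> real_trig_space N"
proof -
  have "(\<lambda>x. complex_of_real (nodal N j x))
      = (\<lambda>x. \<Sum>k\<in>{- int N..int N}. (wave (- k) (node N j) / (2 * N + 1)) * wave k x)"
    by (simp add: of_real_nodal sum_divide_distrib)
  then show ?thesis unfolding real_trig_space_iff by (simp only: trig_spaceI)
qed

lemma real_trig_space_interpolation:
  assumes "u \<in> real_trig_space N"
  shows "u x = (\<Sum>j\<le>2*N. u (node N j) * nodal N j x)"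
proof -
  have "complex_of_real (u x) = of_real (\<Sum>j\<le>2*N. u (node N j) * nodal N j x)"
    using trig_space_interpolation[of "\<lambda>x. complex_of_real (u x)" N x] assms
    by (simp add: real_trig_space_iff)
  then show ?thesis by (simp only: of_real_eq_iff)
qed

lemma real_trig_space_periodic: "u \<in> real_trig_space N \<Longrightarrow> u (x + 2 * pi) = u x"
  unfolding real_trig_space_iff using trig_space_periodic[of "\<lambda>x. complex_of_real (u x)" N x] by simp

lemma real_trig_space_pi: "u \<in> real_trig_space N \<Longrightarrow> u (- pi) = u pi"
  using real_trig_space_periodic[of u N "- pi"] by simp

text \<open>Termwise differentiation yields a complex trigonometric polynomial. Its imaginary part
  is the derivative of zero, so it is real-valued.\<close>

lemma real_trig_space_deriv:
  assumes "u \<in> real_trig_space N"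
  shows "deriv u \<in> real_trig_space N" and "(u has_real_derivative deriv u x) (at x)"
proof -
  obtain g where g: "g \<in> trig_space N" "\<And>x. ((\<lambda>x. complex_of_real (u x)) has_vector_derivative g x) (at x)"
    using assms trig_space_has_derivative unfolding real_trig_space_iff by blast
  have "((\<lambda>x. Im (complex_of_real (u x))) has_vector_derivative Im (g x)) (at x)" for x
    by (rule bounded_linear.has_vector_derivative[OF bounded_linear_Im g(2)])
  then have "Im (g x) = 0" for x
    using vector_derivative_unique_at[of "\<lambda>x. 0" "Im (g x)" x 0] by simp
  then have "g = (\<lambda>x. complex_of_real (Re (g x)))"
    by (auto simp: complex_eq_iff)
  then have "(\<lambda>x. Re (g x)) \<in> real_trig_space N"
    using g(1) by (metis real_trig_space_iff)
  moreover have "(u has_real_derivative Re (g x)) (at x)" for x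
    using bounded_linear.has_vector_derivative[OF bounded_linear_Re g(2)]
    by (simp add: has_real_derivative_iff_has_vector_derivative)
  moreover from this have "deriv u = (\<lambda>x. Re (g x))"
    by (auto intro: DERIV_imp_deriv)
  ultimately show "deriv u \<in> real_trig_space N" "(u has_real_derivative deriv u x) (at x)"
    by auto
qed

lemma real_trig_space_deriv_power:
  assumes "u \<in> real_trig_space N"
  shows "(deriv ^^ n) u \<in> real_trig_space N"
  by (induction n) (auto simp: assms real_trig_space_deriv)

lemma real_trig_space_deriv_power_has_derivative:
  assumes "u \<in> real_trig_space N"
  shows "((deriv ^^ n) u has_real_derivative (deriv ^^ Suc n) u x) (at x)"
  using real_trig_space_deriv(2)[OF real_trig_space_deriv_power[OF assms]] by simp

lemma real_trig_space_derivs: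
  assumes "u \<in> real_trig_space N"
  shows "(u has_real_derivative deriv u x) (at x)"
    "(deriv u has_real_derivative (deriv ^^ 2) u x) (at x)"
    "((deriv ^^ 2) u has_real_derivative (deriv ^^ 3) u x) (at x)"
    "((deriv ^^ 3) u has_real_derivative (deriv ^^ 4) u x) (at x)"
    "((deriv ^^ 4) u has_real_derivative (deriv ^^ 5) u x) (at x)"
  using real_trig_space_deriv_power_has_derivative[OF assms, of 0 x]
    real_trig_space_deriv_power_has_derivative[OF assms, of 1 x]
    real_trig_space_deriv_power_has_derivative[OF assms, of 2 x]
    real_trig_space_deriv_power_has_derivative[OF assms, of 3 x]
    real_trig_space_deriv_power_has_derivative[OF assms, of 4 x]
  by (simp_all add: numeral_eq_Suc)

lemma deriv_power_sum:
  assumes "finite J" "\<And>j. j \<in> J \<Longrightarrow> b j \<in> real_trig_space N"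
  shows "(deriv ^^ n) (\<lambda>x. \<Sum>j\<in>J. a j * b j x) = (\<lambda>x. \<Sum>j\<in>J. a j * (deriv ^^ n) (b j) x)"
proof (induction n)
  case (Suc n)
  have "((\<lambda>x. \<Sum>j\<in>J. a j * (deriv ^^ n) (b j) x) has_real_derivative
      (\<Sum>j\<in>J. a j * (deriv ^^ Suc n) (b j) x)) (at x)" for x
    using assms by (intro DERIV_sum DERIV_cmult real_trig_space_deriv_power_has_derivative) auto
  then show ?case
    using Suc by (auto intro: DERIV_imp_deriv)
qed simp

lemma continuous_on_real_trig_space: "u \<in> real_trig_space N \<Longrightarrow> continuous_on S u"
  by (meson DERIV_isCont continuous_at_imp_continuous_on real_trig_space_deriv(2))

lemma integral_real_trig_space_nodal:
  assumes "u \<in> real_trig_space N"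
  shows "(LINT x|period_measure. u x * nodal N j x) = 2 * pi / (2 * N + 1) * u (node N j)"
proof -
  have "complex_of_real (LINT x|period_measure. u x * nodal N j x) = of_real (2 * pi / (2 * N + 1) * u (node N j))"
    using integral_trig_space_nodal[of "\<lambda>x. complex_of_real (u x)" N j] assms
    by (simp add: real_trig_space_iff flip: of_real_mult)
  then show ?thesis by (simp only: of_real_eq_iff)
qed

lemma integral_times_linear_combination:
  fixes G :: "real \<Rightarrow> real" and b :: "'i \<Rightarrow> real \<Rightarrow> real"
  assumes "\<And>j. j \<in> J \<Longrightarrow> integrable M (\<lambda>x. G x * b j x)"
  shows "(LINT x|M. G x * (\<Sum>j\<in>J. a j * b j x)) = (\<Sum>j\<in>J. a j * (LINT x|M. G x * b j x))"
proof -
  have "(\<lambda>x. G x * (\<Sum>j\<in>J. a j * b j x)) = (\<lambda>x. \<Sum>j\<in>J. a j * (G x * b j x))"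
    by (simp add: sum_distrib_left mult.left_commute)
  then show ?thesis using assms by (simp add: Bochner_Integration.integral_sum)
qed

lemma integral_times_real_trig_space:
  assumes "\<And>j. j \<le> 2 * N \<Longrightarrow> integrable period_measure (\<lambda>x. G x * nodal N j x)" and v: "v \<in> real_trig_space N"
  shows "(LINT x|period_measure. G x * v x)
    = (\<Sum>j\<le>2*N. v (node N j) * (LINT x|period_measure. G x * nodal N j x))"
proof -
  have "G x * v x = G x * (\<Sum>j\<le>2*N. v (node N j) * nodal N j x)" for x
    using real_trig_space_interpolation[OF v, of x] by (rule arg_cong)
  then have "(LINT x|period_measure. G x * v x) = (LINT x|period_measure. G x * (\<Sum>j\<le>2*N. v (node N j) * nodal N j x))"
    by (rule Bochner_Integration.integral_cong[OF refl])
  also have "\<dots> = (\<Sum>j\<le>2*N. v (node N j) * (LINT x|period_measure. G x * nodal N j x))"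
    using assms(1) by (intro integral_times_linear_combination) simp
  finally show ?thesis .
qed

lemma node_weight_cancel: "2 * pi / real (2 * N + 1) * ((2 * real N + 1) / (2 * pi) * x) = x"
proof -
  have nz: "2 * real N + 1 \<noteq> 0"
    using of_nat_0_le_iff[of N, where 'a = real] by linarith
  have eq: "real (2 * N + 1) = 2 * real N + 1"
    by simp
  have "d / c * (c / d * x) = x" if "c \<noteq> 0" "d \<noteq> 0" for c d :: real
    using that by simp
  from this[OF nz, of "2 * pi"] show ?thesis
    unfolding eq by simp
qed

section \<open>The projection as an explicit formula\<close>

text \<open>The orthogonal expansion in the nodal basis. The normalising factor is the reciprocal of
  2 pi / (2N+1), the squared L2 norm of each basis function.\<close>

definition real_proj :: "nat \<Rightarrow> (real \<Rightarrow> real) \<Rightarrow> real \<Rightarrow> real" where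
  "real_proj N f x =
     (\<Sum>j\<le>2*N. (2 * N + 1) / (2 * pi) * (LINT y|period_measure. f y * nodal N j y) * nodal N j x)"

lemma real_proj_in_real_trig_space: "real_proj N f \<in> real_trig_space N"
  unfolding real_proj_def[abs_def] by (intro real_trig_space_sum nodal_in_real_trig_space) auto

lemma real_proj_node:
  assumes "j \<le> 2 * N"
  shows "real_proj N f (node N j) = (2 * N + 1) / (2 * pi) * (LINT y|period_measure. f y * nodal N j y)"
proof -
  have "real_proj N f (node N j)
      = (\<Sum>i\<le>2*N. if i = j then (2 * N + 1) / (2 * pi) * (LINT y|period_measure. f y * nodal N i y) else 0)"
    unfolding real_proj_def using assms by (intro sum.cong) (auto simp: nodal_node)
  then show ?thesis using assms by simp
qed

lemma integral_real_proj:
  assumes f: "\<And>j. integrable period_measure (\<lambda>x. f x * nodal N j x)" and v: "v \<in> real_trig_space N"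
  shows "(LINT x|period_measure. real_proj N f x * v x) = (LINT x|period_measure. f x * v x)"
proof -
  have p: "integrable period_measure (\<lambda>x. real_proj N f x * nodal N j x)" for j
    by (intro continuous_imp_integrable_real continuous_intros continuous_on_real_trig_space[OF real_proj_in_real_trig_space]
        continuous_on_real_trig_space[OF nodal_in_real_trig_space])
  have "(LINT x|period_measure. real_proj N f x * nodal N j x)
      = (LINT x|period_measure. f x * nodal N j x)" if "j \<le> 2 * N" for j
    unfolding integral_real_trig_space_nodal[OF real_proj_in_real_trig_space] real_proj_node[OF that]
    by (rule node_weight_cancel)
  then show ?thesis
    by (simp add: integral_times_real_trig_space[OF _ v] f p)
qed

text \<open>The nodal functions are real, so a complex test function enters only through the
  conjugates of its point values. This reduces complex test functions to real ones.\<close>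

lemma L2_inner_trig_space:
  assumes r: "\<And>j. integrable period_measure (\<lambda>x. r x * nodal N j x)" and \<phi>: "\<phi> \<in> trig_space N"
  shows "L2_inner (\<lambda>x. complex_of_real (r x)) \<phi>
      = (\<Sum>j\<le>2*N. cnj (\<phi> (node N j)) * of_real (LINT x|period_measure. r x * nodal N j x))"
proof -
  have "complex_of_real (r x) * cnj (\<phi> x)
      = (\<Sum>j\<le>2*N. cnj (\<phi> (node N j)) * of_real (r x * nodal N j x))" for x
    by (subst trig_space_interpolation[OF \<phi>]) (simp add: sum_distrib_left mult_ac)
  moreover have "integrable period_measure (\<lambda>x. complex_of_real (r x * nodal N j x))" for j
    using r by (simp only: integrable_of_real)
  ultimately show ?thesis
    unfolding L2_inner_def
    by (simp add: Bochner_Integration.integral_sum del: of_real_mult)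
qed

text \<open>Testing a candidate, not assumed real, against the nodal functions reads off its values
  at the nodes, and interpolation then determines it everywhere.\<close>

lemma L2_proj_of_real:
  assumes f: "\<And>j. integrable period_measure (\<lambda>x. f x * nodal N j x)"
  shows "L2_proj N (\<lambda>x. complex_of_real (f x)) = (\<lambda>x. complex_of_real (real_proj N f x))"
  unfolding L2_proj_def
proof (rule the_equality, intro conjI ballI)
  show "(\<lambda>x. complex_of_real (real_proj N f x)) \<in> trig_space N"
    using real_proj_in_real_trig_space unfolding real_trig_space_iff .
next
  fix \<phi> assume \<phi>: "\<phi> \<in> trig_space N"
  have p: "integrable period_measure (\<lambda>x. real_proj N f x * nodal N j x)" for j
    by (intro continuous_imp_integrable_real continuous_intros continuous_on_real_trig_space[OF real_proj_in_real_trig_space]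
        continuous_on_real_trig_space[OF nodal_in_real_trig_space])
  have "L2_inner (\<lambda>x. complex_of_real (f x - real_proj N f x)) \<phi>
      = (\<Sum>j\<le>2*N. cnj (\<phi> (node N j)) * of_real (LINT x|period_measure. (f x - real_proj N f x) * nodal N j x))"
    using f p \<phi> by (intro L2_inner_trig_space) (auto simp: left_diff_distrib)
  also have "\<dots> = 0"
    using f p by (simp add: left_diff_distrib integral_real_proj nodal_in_real_trig_space)
  finally show "L2_inner (\<lambda>x. complex_of_real (f x) - complex_of_real (real_proj N f x)) \<phi> = 0"
    by simp
next
  fix g assume g: "g \<in> trig_space N \<and> (\<forall>\<phi>\<in>trig_space N. L2_inner (\<lambda>x. complex_of_real (f x) - g x) \<phi> = 0)"
  have "g (node N j) = real_proj N f (node N j)" if j: "j \<le> 2 * N" for j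
  proof -
    have "integrable period_measure (\<lambda>x. complex_of_real (f x * nodal N j x))"
      using f by (simp only: integrable_of_real)
    moreover have "integrable period_measure (\<lambda>x. g x * of_real (nodal N j x))"
      using g by (intro continuous_imp_integrable_real continuous_intros continuous_on_trig_space
        continuous_on_real_trig_space[OF nodal_in_real_trig_space]) auto
    ultimately have "L2_inner (\<lambda>x. complex_of_real (f x) - g x) (\<lambda>x. complex_of_real (nodal N j x))
        = (LINT x|period_measure. complex_of_real (f x * nodal N j x))
          - (LINT x|period_measure. g x * of_real (nodal N j x))"
      unfolding L2_inner_def by (simp add: left_diff_distrib)
    moreover have "L2_inner (\<lambda>x. complex_of_real (f x) - g x) (\<lambda>x. complex_of_real (nodal N j x)) = 0"
      using g nodal_in_real_trig_space by (auto simp: real_trig_space_iff)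
    ultimately have "of_real (2 * pi / (2 * N + 1)) * g (node N j) = of_real (LINT x|period_measure. f x * nodal N j x)"
      using g integral_trig_space_nodal[of g N j] by (simp del: of_real_mult)
    also have "\<dots> = of_real (2 * pi / (2 * N + 1)) * complex_of_real (real_proj N f (node N j))"
      unfolding real_proj_node[OF j] of_real_mult[symmetric] node_weight_cancel ..
    finally have "complex_of_real (2 * pi / (2 * N + 1)) * g (node N j)
        = complex_of_real (2 * pi / (2 * N + 1)) * of_real (real_proj N f (node N j))" .
    moreover have "complex_of_real (2 * pi / (2 * N + 1)) \<noteq> 0"
      unfolding of_real_eq_0_iff by (simp only: divide_eq_0_iff of_nat_eq_0_iff) simp
    ultimately show ?thesis
      by (metis mult_left_cancel)
  qed
  then have eq: "(\<Sum>j\<le>2*N. g (node N j) * of_real (nodal N j x))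
      = (\<Sum>j\<le>2*N. of_real (real_proj N f (node N j)) * of_real (nodal N j x))" for x
    by (intro sum.cong) auto
  show "g = (\<lambda>x. complex_of_real (real_proj N f x))"
  proof
    fix x
    have "g x = (\<Sum>j\<le>2*N. g (node N j) * of_real (nodal N j x))"
      using g by (intro trig_space_interpolation) simp
    also note eq
    also have "(\<Sum>j\<le>2*N. of_real (real_proj N f (node N j)) * of_real (nodal N j x)) = complex_of_real (real_proj N f x)"
      using real_proj_in_real_trig_space unfolding real_trig_space_iff
      by (rule trig_space_interpolation[symmetric])
    finally show "g x = complex_of_real (real_proj N f x)" .
  qed
qed

lemma square_integrable_per_imp_integrable_times:
  assumes "square_integrable_per f" and v: "continuous_on {-pi..pi} v"
  shows "integrable period_measure (\<lambda>x. f x * v x)"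
proof (rule Bochner_Integration.integrable_bound)
  have "integrable period_measure (\<lambda>x. (v x)\<^sup>2)"
    using v by (intro continuous_imp_integrable_real continuous_intros)
  then show "integrable period_measure (\<lambda>x. (f x)\<^sup>2 + (v x)\<^sup>2)"
    using assms unfolding square_integrable_per_def by auto
  show "(\<lambda>x. f x * v x) \<in> borel_measurable period_measure"
    using assms continuous_imp_integrable_real[OF v] unfolding square_integrable_per_def
    by (intro borel_measurable_times) auto
  have "norm (f x * v x) \<le> norm ((f x)\<^sup>2 + (v x)\<^sup>2)" for x
  proof -
    have "2 * \<bar>f x * v x\<bar> \<le> (f x)\<^sup>2 + (v x)\<^sup>2"
      using sum_squares_bound[of "\<bar>f x\<bar>" "\<bar>v x\<bar>"] by (simp add: abs_mult mult.assoc)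
    then show ?thesis by simp
  qed
  then show "AE x in period_measure. norm (f x * v x) \<le> norm ((f x)\<^sup>2 + (v x)\<^sup>2)"
    by simp
qed

subsection \<open>Differentiation under the integral sign\<close>

text \<open>The closure of the separated functions \<open>\<alpha> s * \<beta> x\<close> under addition: on them,
  differentiation in time commutes with integration in space for purely algebraic reasons.\<close>

inductive time_diff :: "real \<Rightarrow> (real \<Rightarrow> real \<Rightarrow> real) \<Rightarrow> (real \<Rightarrow> real) \<Rightarrow> bool" for t where
  separated: "(\<alpha> has_real_derivative \<alpha>') (at t within {0..}) \<Longrightarrow> continuous_on UNIV \<beta> \<Longrightarrow>
    time_diff t (\<lambda>s x. \<alpha> s * \<beta> x) (\<lambda>x. \<alpha>' * \<beta> x)"
| add: "time_diff t g g' \<Longrightarrow> time_diff t h h' \<Longrightarrow>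
    time_diff t (\<lambda>s x. g s x + h s x) (\<lambda>x. g' x + h' x)"
| cong: "time_diff t g g' \<Longrightarrow> (\<And>s x. 0 \<le> s \<Longrightarrow> h s x = g s x) \<Longrightarrow> (\<And>x. h' x = g' x) \<Longrightarrow> time_diff t h h'"

text \<open>A product of separated functions is again separated; one induction per factor extends
  the product rule to sums. The sign of \<open>t\<close> matters because \<open>cong\<close>
  controls values only at nonnegative times, and the product rule evaluates the factors at
  \<open>t\<close>.\<close>

lemma time_diff_mult:
  assumes "0 \<le> t" and g: "time_diff t g g'" and h: "time_diff t h h'"
  shows "time_diff t (\<lambda>s x. g s x * h s x) (\<lambda>x. g' x * h t x + g t x * h' x)"
  using g
proof (induction rule: time_diff.induct)
  case (separated \<alpha> \<alpha>' \<beta>)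
  note \<alpha> = separated
  show ?case
    using h
  proof (induction rule: time_diff.induct)
    case (separated \<gamma> \<gamma>' \<delta>)
    have "time_diff t (\<lambda>s x. (\<alpha> s * \<gamma> s) * (\<beta> x * \<delta> x)) (\<lambda>x. (\<alpha>' * \<gamma> t + \<gamma>' * \<alpha> t) * (\<beta> x * \<delta> x))"
      using \<alpha> separated by (intro time_diff.separated DERIV_mult continuous_on_mult)
    then show ?case by (rule time_diff.cong) (simp_all add: algebra_simps)
  next
    case (add g g' h h')
    from add.IH show ?case
      by (rule time_diff.cong[OF time_diff.add]) (simp_all add: algebra_simps)
  next
    case (cong g g' h h')
    show ?case
      by (rule time_diff.cong[OF cong.IH]) (use cong \<open>0 \<le> t\<close> in auto)
  qed
next
  case (add g g' h h')
  from add.IH show ?case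
    by (rule time_diff.cong[OF time_diff.add]) (simp_all add: algebra_simps)
next
  case (cong g g' k k')
  show ?case
    by (rule time_diff.cong[OF cong.IH]) (use cong \<open>0 \<le> t\<close> in auto)
qed

lemma time_diff_cmult:
  assumes "time_diff t g g'"
  shows "time_diff t (\<lambda>s x. c * g s x) (\<lambda>x. c * g' x)"
  using assms
proof (induction rule: time_diff.induct)
  case (separated \<alpha> \<alpha>' \<beta>)
  have "time_diff t (\<lambda>s x. (c * \<alpha> s) * \<beta> x) (\<lambda>x. (c * \<alpha>') * \<beta> x)"
    using separated by (intro time_diff.separated DERIV_cmult)
  then show ?case by (simp add: mult.assoc)
next
  case (add g g' h h')
  from add.IH show ?case
    by (rule time_diff.cong[OF time_diff.add]) (simp_all add: algebra_simps)
next
  case (cong g g' h h')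
  show ?case
    by (rule time_diff.cong[OF cong.IH]) (use cong in auto)
qed

lemma time_diff_sum:
  assumes "finite J" "\<And>j. j \<in> J \<Longrightarrow> (\<alpha> j has_real_derivative \<alpha>' j) (at t within {0..})"
    "\<And>j. j \<in> J \<Longrightarrow> continuous_on UNIV (\<beta> j)"
  shows "time_diff t (\<lambda>s x. \<Sum>j\<in>J. \<alpha> j s * \<beta> j x) (\<lambda>x. \<Sum>j\<in>J. \<alpha>' j * \<beta> j x)"
  using assms
proof (induction J)
  case empty
  have "time_diff t (\<lambda>s x. 0 * 0) (\<lambda>x. 0 * 0)"
    by (rule time_diff.separated) auto
  then show ?case by simp
next
  case (insert j J)
  then have "time_diff t (\<lambda>s x. \<alpha> j s * \<beta> j x + (\<Sum>j\<in>J. \<alpha> j s * \<beta> j x)) (\<lambda>x. \<alpha>' j * \<beta> j x + (\<Sum>j\<in>J. \<alpha>' j * \<beta> j x))"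
    by (intro time_diff.add time_diff.separated) auto
  then show ?case using insert by simp
qed

lemma time_diff_continuous:
  assumes "time_diff t g g'"
  shows "continuous_on UNIV g'" and "0 \<le> s \<Longrightarrow> continuous_on UNIV (g s)"
  using assms by (induction rule: time_diff.induct) (auto intro!: continuous_intros simp: fun_eq_iff cong: continuous_on_cong)

lemma time_diff_integral:
  assumes "0 \<le> t" "time_diff t g g'"
  shows "((\<lambda>s. LINT x|period_measure. g s x) has_real_derivative (LINT x|period_measure. g' x)) (at t within {0..})"
  using assms(2)
proof (induction rule: time_diff.induct)
  case (separated \<alpha> \<alpha>' \<beta>)
  then show ?case by (simp add: DERIV_cmult_right)
next
  case (add g g' h h')
  have i: "integrable period_measure k" if "continuous_on UNIV k" for k :: "real \<Rightarrow> real"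
    using that continuous_on_subset by (blast intro: continuous_imp_integrable_real)
  have "((\<lambda>s. (LINT x|period_measure. g s x) + (LINT x|period_measure. h s x)) has_real_derivative
      (LINT x|period_measure. g' x + h' x)) (at t within {0..})"
    using DERIV_add[OF add.IH] time_diff_continuous[OF add.hyps(1)] time_diff_continuous[OF add.hyps(2)]
    by (simp add: i)
  \<comment> \<open>The integral splits only for nonnegative s, where the integrands are known to be
    continuous; a derivative within the half line sees nothing else.\<close>
  then show ?case
    by (rule has_field_derivative_transform_within[OF _ zero_less_one])
      (use \<open>0 \<le> t\<close> in \<open>auto simp: i time_diff_continuous[OF add.hyps(1)] time_diff_continuous[OF add.hyps(2)]\<close>)
next
  case (cong g g' h h')
  have "((\<lambda>s. LINT x|period_measure. g s x) has_real_derivative (LINT x|period_measure. h' x)) (at t within {0..})"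
    using cong.IH cong.hyps by simp
  then show ?case
    by (rule has_field_derivative_transform_within[OF _ zero_less_one])
      (use \<open>0 \<le> t\<close> cong.hyps in auto)
qed

lemma integral_period_real_derivative:
  fixes g :: "real \<Rightarrow> real"
  assumes "\<And>x. (g has_real_derivative g' x) (at x)" "continuous_on {-pi..pi} g'" "g (- pi) = g pi"
  shows "(LINT x|period_measure. g' x) = 0"
  using assms by (intro integral_period_derivative[of g]) (auto simp: has_real_derivative_iff_has_vector_derivative)

text \<open>Exactness of the quadrature rule for products, obtained from the reproducing property.
  It turns a vanishing L2 norm into vanishing values at the nodes.\<close>

lemma integral_real_trig_space_mult:
  assumes "u \<in> real_trig_space N" "v \<in> real_trig_space N"
  shows "(LINT x|period_measure. u x * v x) = 2 * pi / (2 * N + 1) * (\<Sum>j\<le>2*N. u (node N j) * v (node N j))"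
proof -
  have "integrable period_measure (\<lambda>x. u x * nodal N j x)" for j
    by (intro continuous_imp_integrable_real continuous_intros
        continuous_on_real_trig_space[OF assms(1)] continuous_on_real_trig_space[OF nodal_in_real_trig_space])
  then have "(LINT x|period_measure. u x * v x) = (\<Sum>j\<le>2*N. v (node N j) * (2 * pi / (2 * N + 1) * u (node N j)))"
    by (simp only: integral_times_real_trig_space[OF _ assms(2)] integral_real_trig_space_nodal[OF assms(1)])
  then show ?thesis by (simp only: sum_distrib_left mult_ac)
qed

subsection \<open>Integral identities of the Kawahara operator\<close>

definition kawahara_op :: "(real \<Rightarrow> real) \<Rightarrow> real \<Rightarrow> real" where
  "kawahara_op u x = u x * deriv u x + (deriv ^^ 3) u x - (deriv ^^ 5) u x"

text \<open>Both the spatial antiderivative of \<open>kawahara_op u\<close> and half the variational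
  derivative of the third conserved functional; this double role is the Hamiltonian structure of the
  equation.\<close>

definition kawahara_flux :: "(real \<Rightarrow> real) \<Rightarrow> real \<Rightarrow> real" where
  "kawahara_flux u x = (u x)\<^sup>2 / 2 + (deriv ^^ 2) u x - (deriv ^^ 4) u x"

lemma kawahara_residual_eq:
  "kawahara_residual U t = (\<lambda>x. time_deriv U t x + kawahara_op (U t) x)"
  by (simp add: kawahara_residual_def kawahara_op_def fun_eq_iff)

lemma continuous_on_trig_derivs:
  assumes "u \<in> real_trig_space N"
  shows "continuous_on S u" "continuous_on S (deriv u)" "continuous_on S ((deriv ^^ n) u)"
  using assms by (auto intro: continuous_on_real_trig_space real_trig_space_deriv real_trig_space_deriv_power)

lemma trig_derivs_pi:
  assumes "u \<in> real_trig_space N"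
  shows "u (- pi) = u pi" "deriv u (- pi) = deriv u pi" "(deriv ^^ n) u (- pi) = (deriv ^^ n) u pi"
  using assms by (auto intro: real_trig_space_pi real_trig_space_deriv real_trig_space_deriv_power)

lemma continuous_on_kawahara:
  assumes "u \<in> real_trig_space N"
  shows "continuous_on S (kawahara_op u)" "continuous_on S (kawahara_flux u)"
  unfolding kawahara_op_def[abs_def] kawahara_flux_def[abs_def]
  by (intro continuous_intros continuous_on_trig_derivs[OF assms]; simp)+

lemma kawahara_flux_has_derivative:
  assumes "u \<in> real_trig_space N"
  shows "(kawahara_flux u has_real_derivative kawahara_op u x) (at x)"
  unfolding kawahara_op_def kawahara_flux_def[abs_def]
  by (auto intro!: derivative_eq_intros real_trig_space_derivs[OF assms])

lemma kawahara_flux_pi: "u \<in> real_trig_space N \<Longrightarrow> kawahara_flux u (- pi) = kawahara_flux u pi"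
  by (simp add: kawahara_flux_def trig_derivs_pi)

lemma integral_kawahara_op:
  assumes "u \<in> real_trig_space N"
  shows "(LINT x|period_measure. kawahara_op u x) = 0"
  by (intro integral_period_real_derivative[of "kawahara_flux u"] kawahara_flux_has_derivative[OF assms]
      continuous_on_kawahara[OF assms] kawahara_flux_pi[OF assms])

text \<open>With s = u + v and d = u - v, the nonlinear difference is half the derivative of s d,
  while the odd-order linear terms are skew and drop out. What remains contains no derivative of d,
  so a bound on the derivative of s suffices for a Gronwall estimate.\<close>

lemma integral_kawahara_op_diff:
  assumes u: "u \<in> real_trig_space N" and v: "v \<in> real_trig_space N"
  shows "(LINT x|period_measure. (kawahara_op u x - kawahara_op v x) * (u x - v x))
    = 1 / 4 * (LINT x|period_measure. (deriv u x + deriv v x) * (u x - v x)\<^sup>2)"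
proof -
  define d where "d n x = (deriv ^^ n) u x - (deriv ^^ n) v x" for n x
  \<comment> \<open>The three summands are potentials for the nonlinear part (after subtracting the
    right-hand side), for d times its third derivative, and for d times its fifth.\<close>
  define g where "g x = (u x + v x) * (u x - v x)\<^sup>2 / 4 + ((u x - v x) * d 2 x - (deriv u x - deriv v x)\<^sup>2 / 2)
      - ((u x - v x) * d 4 x - (deriv u x - deriv v x) * d 3 x + (d 2 x)\<^sup>2 / 2)" for x
  define g' where "g' x = (kawahara_op u x - kawahara_op v x) * (u x - v x)
      - 1 / 4 * ((deriv u x + deriv v x) * (u x - v x)\<^sup>2)" for x
  have "(g has_real_derivative g' x) (at x)" for x
    unfolding g_def[abs_def] g'_def d_def kawahara_op_def
    by (auto intro!: derivative_eq_intros real_trig_space_derivs[OF u] real_trig_space_derivs[OF v]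
        simp: field_simps power2_eq_square)
  moreover have "continuous_on {-pi..pi} g'"
    unfolding g'_def by (intro continuous_intros continuous_on_trig_derivs[OF u] continuous_on_trig_derivs[OF v]
        continuous_on_kawahara[OF u] continuous_on_kawahara[OF v])
  moreover have "g (- pi) = g pi"
    by (simp add: g_def d_def trig_derivs_pi[OF u] trig_derivs_pi[OF v])
  ultimately have "(LINT x|period_measure. g' x) = 0"
    by (rule integral_period_real_derivative)
  moreover have "integrable period_measure (\<lambda>x. (kawahara_op u x - kawahara_op v x) * (u x - v x))"
    "integrable period_measure (\<lambda>x. (deriv u x + deriv v x) * (u x - v x)\<^sup>2)"
    by (intro continuous_imp_integrable_real continuous_intros continuous_on_trig_derivs[OF u] continuous_on_trig_derivs[OF v]
        continuous_on_kawahara[OF u] continuous_on_kawahara[OF v])+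
  ultimately show ?thesis unfolding g'_def by simp
qed

text \<open>Besides the second conservation law, this gives the norm conservation on which global
  existence rests.\<close>

lemma integral_kawahara_op_self:
  assumes u: "u \<in> real_trig_space N"
  shows "(LINT x|period_measure. kawahara_op u x * u x) = 0"
proof (rule integral_period_real_derivative)
  show "((\<lambda>x. u x ^ 3 / 3 + (u x * (deriv ^^ 2) u x - (deriv u x)\<^sup>2 / 2)
      - (u x * (deriv ^^ 4) u x - deriv u x * (deriv ^^ 3) u x + ((deriv ^^ 2) u x)\<^sup>2 / 2))
      has_real_derivative kawahara_op u x * u x) (at x)" for x
    unfolding kawahara_op_def
    by (auto intro!: derivative_eq_intros real_trig_space_derivs[OF u] simp: field_simps power2_eq_square)
  show "continuous_on {-pi..pi} (\<lambda>x. kawahara_op u x * u x)"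
    by (intro continuous_intros continuous_on_trig_derivs[OF u] continuous_on_kawahara[OF u])
qed (simp add: trig_derivs_pi[OF u])

text \<open>The flux \<open>G\<close> is not an admissible test function, but its projection \<open>g\<close> is,
  and \<open>\<integral> G' g = - \<integral> G g' = - \<integral> g g' = 0\<close>.\<close>

lemma integral_kawahara_flux_times_velocity:
  assumes u: "u \<in> real_trig_space N" and w: "w \<in> real_trig_space N"
    and weak: "\<And>v. v \<in> real_trig_space N \<Longrightarrow> (LINT x|period_measure. (w x + kawahara_op u x) * v x) = 0"
  shows "(LINT x|period_measure. kawahara_flux u x * w x) = 0"
proof -
  define g where "g = real_proj N (kawahara_flux u)"
  have g: "g \<in> real_trig_space N" unfolding g_def by (rule real_proj_in_real_trig_space)
  have proj: "(LINT x|period_measure. g x * v x) = (LINT x|period_measure. kawahara_flux u x * v x)"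
    if "v \<in> real_trig_space N" for v
    unfolding g_def using that
    by (intro integral_real_proj continuous_imp_integrable_real continuous_intros
        continuous_on_kawahara[OF u] continuous_on_real_trig_space[OF nodal_in_real_trig_space])
  note [continuous_intros] = continuous_on_kawahara[OF u] continuous_on_trig_derivs[OF g] continuous_on_trig_derivs[OF w]
  have int: "integrable period_measure (\<lambda>x. kawahara_op u x * g x)" "integrable period_measure (\<lambda>x. kawahara_flux u x * deriv g x)"
    "integrable period_measure (\<lambda>x. w x * g x)"
    by (intro continuous_imp_integrable_real continuous_intros)+
  have "(LINT x|period_measure. g x * deriv g x) = 0"
    by (rule integral_period_real_derivative[of "\<lambda>x. (g x)\<^sup>2 / 2"])
      (auto intro!: derivative_eq_intros continuous_intros real_trig_space_derivs[OF g] simp: trig_derivs_pi[OF g])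
  then have "(LINT x|period_measure. kawahara_flux u x * deriv g x) = 0"
    using proj[OF real_trig_space_deriv(1)[OF g]] by simp
  moreover have "(LINT x|period_measure. kawahara_op u x * g x + kawahara_flux u x * deriv g x) = 0"
    by (rule integral_period_real_derivative[of "\<lambda>x. kawahara_flux u x * g x"])
      (auto intro!: derivative_eq_intros continuous_intros real_trig_space_derivs[OF g] kawahara_flux_has_derivative[OF u]
        simp: trig_derivs_pi[OF g] kawahara_flux_pi[OF u])
  ultimately have "(LINT x|period_measure. kawahara_op u x * g x) = 0"
    using int by simp
  moreover have "(LINT x|period_measure. w x * g x + kawahara_op u x * g x) = 0"
    using weak[OF g] by (simp add: distrib_right)
  ultimately have "(LINT x|period_measure. g x * w x) = 0"
    using int by (simp add: mult.commute)
  \<comment> \<open>The velocity \<open>w\<close> lies in the space itself, so the projected flux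
    may be replaced by the flux.\<close>
  then show ?thesis using proj[OF w] by simp
qed

text \<open>The integrand on the left is the first variation, in direction \<open>w\<close>, of the
  density of the third functional; the potential in the proof moves all derivatives off
  \<open>w\<close>.\<close>

lemma integral_hamiltonian_derivative:
  assumes u: "u \<in> real_trig_space N" and w: "w \<in> real_trig_space N"
  shows "(LINT x|period_measure. (u x)\<^sup>2 * w x - 2 * (deriv u x * deriv w x) - 2 * ((deriv ^^ 2) u x * (deriv ^^ 2) w x))
    = 2 * (LINT x|period_measure. kawahara_flux u x * w x)"
proof -
  note [continuous_intros] = continuous_on_kawahara[OF u] continuous_on_trig_derivs[OF u] continuous_on_trig_derivs[OF w]
  have "(LINT x|period_measure. ((u x)\<^sup>2 * w x - 2 * (deriv u x * deriv w x) - 2 * ((deriv ^^ 2) u x * (deriv ^^ 2) w x))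
      - 2 * (kawahara_flux u x * w x)) = 0"
  proof (rule integral_period_real_derivative)
    show "((\<lambda>x. 2 * ((deriv ^^ 3) u x * w x - deriv u x * w x - (deriv ^^ 2) u x * deriv w x)) has_real_derivative
      ((u x)\<^sup>2 * w x - 2 * (deriv u x * deriv w x) - 2 * ((deriv ^^ 2) u x * (deriv ^^ 2) w x))
      - 2 * (kawahara_flux u x * w x)) (at x)" for x
      unfolding kawahara_flux_def
      by (auto intro!: derivative_eq_intros real_trig_space_derivs[OF u] real_trig_space_derivs[OF w] simp: algebra_simps)
  qed (auto intro!: continuous_intros simp: trig_derivs_pi[OF u] trig_derivs_pi[OF w])
  moreover have "integrable period_measure (\<lambda>x. (u x)\<^sup>2 * w x - 2 * (deriv u x * deriv w x) - 2 * ((deriv ^^ 2) u x * (deriv ^^ 2) w x))"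
    "integrable period_measure (\<lambda>x. kawahara_flux u x * w x)"
    by (intro continuous_imp_integrable_real continuous_intros)+
  ultimately show ?thesis by simp
qed

subsection \<open>The Galerkin equation\<close>

lemma at_within_Ici_neq_bot: "0 \<le> t \<Longrightarrow> at t within {0..} \<noteq> bot" for t :: real
  using at_within_Icc_eq_Ici[of t] by (simp add: trivial_limit_within flip: at_within_Icc_eq_Ici)

lemma time_deriv_eqI:
  assumes "0 \<le> t" "((\<lambda>s. U s x) has_real_derivative d) (at t within {0..})"
  shows "time_deriv U t x = d"
  unfolding time_deriv_def using assms at_within_Ici_neq_bot
  by (intro vector_derivative_within) (auto simp: has_real_derivative_iff_has_vector_derivative)

text \<open>Interpolation writes the curve as a finite sum of node values, depending on time, times
  fixed functions of x. Hence the velocity stays in the space, and time and space derivatives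
  commute.\<close>

lemma real_trig_space_curve:
  fixes U :: "real \<Rightarrow> real \<Rightarrow> real"
  assumes U: "\<And>s. 0 \<le> s \<Longrightarrow> U s \<in> real_trig_space N" and t: "0 \<le> t"
    and d: "\<And>x. (\<lambda>s. U s x) differentiable (at t within {0..})"
  shows "time_deriv U t \<in> real_trig_space N"
    and "time_diff t (\<lambda>s. (deriv ^^ n) (U s)) ((deriv ^^ n) (time_deriv U t))"
proof -
  have D: "((\<lambda>s. U s x) has_real_derivative time_deriv U t x) (at t within {0..})" for x
    using d[of x] unfolding time_deriv_def has_real_derivative_iff_has_vector_derivative
    by (simp add: vector_derivative_works)
  have U_eq: "U s = (\<lambda>x. \<Sum>j\<le>2*N. U s (node N j) * nodal N j x)" if "0 \<le> s" for s
    by (rule ext) (rule real_trig_space_interpolation[OF U[OF that]])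
  have W_eq: "time_deriv U t = (\<lambda>x. \<Sum>j\<le>2*N. time_deriv U t (node N j) * nodal N j x)"
  proof (rule ext, rule time_deriv_eqI[OF t])
    fix x
    have "((\<lambda>s. \<Sum>j\<le>2*N. U s (node N j) * nodal N j x) has_real_derivative
        (\<Sum>j\<le>2*N. time_deriv U t (node N j) * nodal N j x)) (at t within {0..})"
      by (intro DERIV_sum DERIV_cmult_right D)
    then show "((\<lambda>s. U s x) has_real_derivative
        (\<Sum>j\<le>2*N. time_deriv U t (node N j) * nodal N j x)) (at t within {0..})"
      by (rule has_field_derivative_transform_within[OF _ zero_less_one])
        (use t U in \<open>auto intro: real_trig_space_interpolation[symmetric]\<close>)
  qed
  show "time_deriv U t \<in> real_trig_space N"
    by (subst W_eq) (intro real_trig_space_sum nodal_in_real_trig_space finite_atMost)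
  have "time_diff t (\<lambda>s x. \<Sum>j\<le>2*N. U s (node N j) * (deriv ^^ n) (nodal N j) x)
      (\<lambda>x. \<Sum>j\<le>2*N. time_deriv U t (node N j) * (deriv ^^ n) (nodal N j) x)"
    by (intro time_diff_sum D continuous_on_trig_derivs[OF nodal_in_real_trig_space]) auto
  then show "time_diff t (\<lambda>s. (deriv ^^ n) (U s)) ((deriv ^^ n) (time_deriv U t))"
  proof (rule time_diff.cong)
    show "(deriv ^^ n) (U s) x = (\<Sum>j\<le>2*N. U s (node N j) * (deriv ^^ n) (nodal N j) x)" if "0 \<le> s" for s x
      by (subst U_eq[OF that], subst deriv_power_sum) (auto intro: nodal_in_real_trig_space)
    show "(deriv ^^ n) (time_deriv U t) x = (\<Sum>j\<le>2*N. time_deriv U t (node N j) * (deriv ^^ n) (nodal N j) x)" for x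
      by (subst W_eq, subst deriv_power_sum) (auto intro: nodal_in_real_trig_space)
  qed
qed

lemma integrable_trig_nodal:
  assumes "continuous_on {-pi..pi} g"
  shows "integrable period_measure (\<lambda>x. g x * nodal N j x)"
  by (intro continuous_imp_integrable_real continuous_intros assms
      continuous_on_real_trig_space[OF nodal_in_real_trig_space])

text \<open>Real test functions are among the complex ones; conversely, pairing the real residual
  with a complex test function is a complex combination of its pairings with the nodal
  functions.\<close>

lemma galerkin_weak_form_iff:
  assumes w: "w \<in> real_trig_space N" and u: "u \<in> real_trig_space N"
  shows "(\<forall>\<phi>\<in>trig_space N. L2_inner (\<lambda>x. complex_of_real (w x + kawahara_op u x)) \<phi> = 0) \<longleftrightarrow>
    (\<forall>v\<in>real_trig_space N. (LINT x|period_measure. (w x + kawahara_op u x) * v x) = 0)"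
    (is "?L = ?R")
proof
  assume ?L
  show ?R
  proof
    fix v assume "v \<in> real_trig_space N"
    then have "L2_inner (\<lambda>x. complex_of_real (w x + kawahara_op u x)) (\<lambda>x. complex_of_real (v x)) = 0"
      using \<open>?L\<close> by (simp only: real_trig_space_iff)
    then show "(LINT x|period_measure. (w x + kawahara_op u x) * v x) = 0"
      by (simp add: L2_inner_def flip: of_real_mult of_real_add)
  qed
next
  assume R: ?R
  have "integrable period_measure (\<lambda>x. (w x + kawahara_op u x) * nodal N j x)" for j
    by (intro integrable_trig_nodal continuous_intros continuous_on_kawahara[OF u] continuous_on_real_trig_space[OF w])
  from L2_inner_trig_space[OF this] show ?L
    using R nodal_in_real_trig_space by simp
qed

lemma galerkin_solution_iff:
  assumes f: "square_integrable_per f"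
  shows "galerkin_solution N f U \<longleftrightarrow>
    U \<in> {0..} \<rightarrow>\<^sub>E real_trig_space N \<and>
    (\<forall>t\<ge>0. \<forall>x. (\<lambda>s. U s x) differentiable (at t within {0..})) \<and>
    (\<forall>t\<ge>0. \<forall>v\<in>real_trig_space N. (LINT x|period_measure. (time_deriv U t x + kawahara_op (U t) x) * v x) = 0) \<and>
    U 0 = real_proj N f"
proof -
  have "L2_proj N (\<lambda>x. complex_of_real (f x)) = (\<lambda>x. complex_of_real (real_proj N f x))"
    by (intro L2_proj_of_real square_integrable_per_imp_integrable_times[OF f]
        continuous_on_real_trig_space[OF nodal_in_real_trig_space])
  then have init: "(\<lambda>x. complex_of_real (U 0 x)) = L2_proj N (\<lambda>x. complex_of_real (f x)) \<longleftrightarrow> U 0 = real_proj N f"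
    by (simp add: fun_eq_iff)
  have weak: "(\<forall>\<phi>\<in>trig_space N. L2_inner (\<lambda>x. complex_of_real (kawahara_residual U t x)) \<phi> = 0) \<longleftrightarrow>
      (\<forall>v\<in>real_trig_space N. (LINT x|period_measure. (time_deriv U t x + kawahara_op (U t) x) * v x) = 0)"
    if "U \<in> {0..} \<rightarrow>\<^sub>E real_trig_space N" "\<forall>t\<ge>0. \<forall>x. (\<lambda>s. U s x) differentiable (at t within {0..})" "0 \<le> t" for t
    unfolding kawahara_residual_eq
    using that by (intro galerkin_weak_form_iff real_trig_space_curve) auto
  show ?thesis
    unfolding galerkin_solution_def init using weak by blast
qed

section \<open>Conservation laws\<close>

lemma galerkin_conservation:
  assumes f: "square_integrable_per f" and sol: "galerkin_solution N f U" and t: "0 \<le> t"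
  shows "((\<lambda>s. LINT x|period_measure. U s x) has_real_derivative 0) (at t within {0..})"
    and "((\<lambda>s. LINT x|period_measure. (U s x)\<^sup>2) has_real_derivative 0) (at t within {0..})"
    and "((\<lambda>s. LINT x|period_measure.
            1 / 3 * (U s x) ^ 3 - (deriv (U s) x)\<^sup>2 - ((deriv ^^ 2) (U s) x)\<^sup>2)
          has_real_derivative 0) (at t within {0..})"
proof -
  define W where "W = time_deriv U t"
  have U: "0 \<le> s \<Longrightarrow> U s \<in> real_trig_space N"
    and d: "(\<lambda>s. U s x) differentiable (at t within {0..})"
    and weak: "v \<in> real_trig_space N \<Longrightarrow> (LINT x|period_measure. (W x + kawahara_op (U t) x) * v x) = 0" for s x v
    using sol t unfolding galerkin_solution_iff[OF f] W_def by auto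
  note u = U[OF t]
  have w: "W \<in> real_trig_space N" and td: "time_diff t (\<lambda>s. (deriv ^^ n) (U s)) ((deriv ^^ n) W)" for n
    unfolding W_def by (rule real_trig_space_curve[OF U t d], assumption)+
  note td0 = td[of 0, simplified] and td1 = td[of 1, simplified] and td2 = td[of 2]
  note [continuous_intros] = continuous_on_kawahara[OF u] continuous_on_trig_derivs[OF u] continuous_on_trig_derivs[OF w]
  have int: "integrable period_measure W" "integrable period_measure (kawahara_op (U t))"
    "integrable period_measure (\<lambda>x. W x * U t x)" "integrable period_measure (\<lambda>x. kawahara_op (U t) x * U t x)"
    by (intro continuous_imp_integrable_real continuous_intros)+

  have one: "(\<lambda>x. 1) \<in> real_trig_space N"
    unfolding real_trig_space_iff trig_space_wave
    by (auto intro!: exI[of _ "\<lambda>k. if k = 0 then 1 else 0"] simp: if_distrib[of "\<lambda>c. c * _"] cong: if_cong)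
  have "(LINT x|period_measure. W x) = 0"
    using weak[OF one] int integral_kawahara_op[OF u] by simp
  then show "((\<lambda>s. LINT x|period_measure. U s x) has_real_derivative 0) (at t within {0..})"
    using time_diff_integral[OF t td0] by simp

  have "(LINT x|period_measure. W x * U t x) = 0"
    using weak[OF u] int integral_kawahara_op_self[OF u] by (simp add: distrib_right)
  moreover have "time_diff t (\<lambda>s x. (U s x)\<^sup>2) (\<lambda>x. 2 * (W x * U t x))"
    using time_diff_mult[OF t td0 td0] by (rule time_diff.cong) (simp_all add: power2_eq_square)
  ultimately show "((\<lambda>s. LINT x|period_measure. (U s x)\<^sup>2) has_real_derivative 0) (at t within {0..})"
    using time_diff_integral[OF t] by fastforce

  have flux: "(LINT x|period_measure. kawahara_flux (U t) x * W x) = 0"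
    by (rule integral_kawahara_flux_times_velocity[OF u w weak])
  have "time_diff t (\<lambda>s x. 1 / 3 * (U s x) ^ 3 - (deriv (U s) x)\<^sup>2 - ((deriv ^^ 2) (U s) x)\<^sup>2)
      (\<lambda>x. (U t x)\<^sup>2 * W x - 2 * (deriv (U t) x * deriv W x) - 2 * ((deriv ^^ 2) (U t) x * (deriv ^^ 2) W x))"
    using time_diff.add[OF time_diff.add[OF
      time_diff_cmult[of t _ _ "1 / 3", OF time_diff_mult[OF t td0 time_diff_mult[OF t td0 td0]]]
      time_diff_cmult[of t _ _ "- 1", OF time_diff_mult[OF t td1 td1]]]
      time_diff_cmult[of t _ _ "- 1", OF time_diff_mult[OF t td2 td2]]]
    by (rule time_diff.cong) (simp_all add: power2_eq_square power3_eq_cube algebra_simps)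
  \<comment> \<open>The derivative is the first variation in the direction of the velocity, that is,
    twice the pairing of flux and velocity, which vanishes.\<close>
  from time_diff_integral[OF t this]
  show "((\<lambda>s. LINT x|period_measure.
            1 / 3 * (U s x) ^ 3 - (deriv (U s) x)\<^sup>2 - ((deriv ^^ 2) (U s) x)\<^sup>2)
          has_real_derivative 0) (at t within {0..})"
    unfolding integral_hamiltonian_derivative[OF u w] flux by simp
qed

section \<open>Uniqueness by an energy estimate\<close>

text \<open>Supplies the constant for Gronwall's inequality. Continuity in time is known only for
  each x separately; a bound uniform in x follows from the finitely many node values and the fixed
  derivatives of the basis.\<close>

lemma real_trig_space_curve_deriv_bounded:
  fixes U :: "real \<Rightarrow> real \<Rightarrow> real"
  assumes U: "\<And>s. 0 \<le> s \<Longrightarrow> U s \<in> real_trig_space N"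
    and d: "\<And>t x. 0 \<le> t \<Longrightarrow> (\<lambda>s. U s x) differentiable (at t within {0..})"
  obtains C where "\<And>s x. s \<in> {0..T} \<Longrightarrow> x \<in> {-pi..pi} \<Longrightarrow> \<bar>deriv (U s) x\<bar> \<le> C"
proof -
  have "\<exists>B. \<forall>x\<in>{-pi..pi}. \<bar>deriv (nodal N j) x\<bar> \<le> B" for j
    using compact_imp_bounded[OF compact_continuous_image[OF
        continuous_on_trig_derivs(2)[OF nodal_in_real_trig_space[of N j]] compact_Icc[of "-pi" pi]]]
    by (auto simp: bounded_iff)
  then obtain B where B: "\<And>j x. x \<in> {-pi..pi} \<Longrightarrow> \<bar>deriv (nodal N j) x\<bar> \<le> B j" by metis
  have "\<exists>A. \<forall>s\<in>{0..T}. \<bar>U s x\<bar> \<le> A" for x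
  proof -
    have "continuous_on {0..} (\<lambda>s. U s x)"
      using d by (auto simp: continuous_on_eq_continuous_within intro: differentiable_imp_continuous_within)
    then have "continuous_on {0..T} (\<lambda>s. U s x)"
      by (rule continuous_on_subset) auto
    from compact_imp_bounded[OF compact_continuous_image[OF this compact_Icc]]
    show ?thesis by (auto simp: bounded_iff)
  qed
  then obtain A where A: "\<And>x s. s \<in> {0..T} \<Longrightarrow> \<bar>U s x\<bar> \<le> A x" by metis
  show ?thesis
  proof
    fix s x assume s: "s \<in> {0..T}" and x: "x \<in> {-pi..pi}"
    have "U s = (\<lambda>x. \<Sum>j\<le>2*N. U s (node N j) * nodal N j x)"
      using s by (intro ext real_trig_space_interpolation U) simp
    from arg_cong[OF this, of "\<lambda>g. (deriv ^^ 1) g"]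
    have "deriv (U s) x = (\<Sum>j\<le>2*N. U s (node N j) * deriv (nodal N j) x)"
      by (subst (asm) deriv_power_sum) (auto intro: nodal_in_real_trig_space)
    also have "\<bar>\<dots>\<bar> \<le> (\<Sum>j\<le>2*N. A (node N j) * B j)"
      using A[OF s] B[OF x]
      by (intro order_trans[OF sum_abs] sum_mono) (auto simp: abs_mult intro!: mult_mono intro: order_trans[OF abs_ge_zero])
    finally show "\<bar>deriv (U s) x\<bar> \<le> (\<Sum>j\<le>2*N. A (node N j) * B j)" .
  qed
qed

text \<open>With the integrating factor exp(-C t) the derivative is nonpositive, and the mean value
  theorem on the whole interval finishes.\<close>

lemma gronwall_zero:
  fixes y :: "real \<Rightarrow> real"
  assumes y: "\<And>t. 0 \<le> t \<Longrightarrow> t \<le> T \<Longrightarrow> (y has_real_derivative y' t) (at t within {0..})"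
    and le: "\<And>t. 0 \<le> t \<Longrightarrow> t \<le> T \<Longrightarrow> y' t \<le> C * y t" and "y 0 = 0" "0 \<le> T"
  shows "y T \<le> 0"
proof -
  define z where "z t = y t * exp (- (C * t))" for t
  have "(z has_derivative (*) ((y' t - C * y t) * exp (- (C * t)))) (at t within {0..T})"
    if "0 \<le> t" "t \<le> T" for t
  proof -
    have "(z has_real_derivative (y' t - C * y t) * exp (- (C * t))) (at t within {0..})"
      unfolding z_def using y[OF that] by (auto intro!: derivative_eq_intros simp: algebra_simps)
    then show ?thesis
      unfolding has_field_derivative_def by (rule has_derivative_subset) auto
  qed
  then obtain t where t: "t \<in> {0..T}" and z: "z T - z 0 = (y' t - C * y t) * exp (- (C * t)) * (T - 0)"
    using mvt_very_simple[of 0 T z "\<lambda>t. (*) ((y' t - C * y t) * exp (- (C * t)))"] \<open>0 \<le> T\<close> by auto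
  have "(y' t - C * y t) * exp (- (C * t)) * (T - 0) \<le> 0"
    using le[of t] t by (intro mult_nonpos_nonneg) auto
  then have "z T \<le> z 0"
    unfolding z[symmetric] by simp
  then show ?thesis
    using \<open>y 0 = 0\<close> by (simp add: z_def mult_le_0_iff)
qed

lemma galerkin_unique:
  assumes f: "square_integrable_per f" and sol: "galerkin_solution N f U" "galerkin_solution N f V"
  shows "U = V"
proof
  fix T
  have U: "0 \<le> s \<Longrightarrow> U s \<in> real_trig_space N" and V: "0 \<le> s \<Longrightarrow> V s \<in> real_trig_space N"
    and dU: "0 \<le> t \<Longrightarrow> (\<lambda>s. U s x) differentiable (at t within {0..})"
    and dV: "0 \<le> t \<Longrightarrow> (\<lambda>s. V s x) differentiable (at t within {0..})"
    and wU: "0 \<le> t \<Longrightarrow> v \<in> real_trig_space N \<Longrightarrow> (LINT x|period_measure. (time_deriv U t x + kawahara_op (U t) x) * v x) = 0"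
    and wV: "0 \<le> t \<Longrightarrow> v \<in> real_trig_space N \<Longrightarrow> (LINT x|period_measure. (time_deriv V t x + kawahara_op (V t) x) * v x) = 0"
    and init: "U 0 = V 0" for s t x v
    using sol unfolding galerkin_solution_iff[OF f] by auto
  show "U T = V T"
  proof (cases "0 \<le> T")
    case False
    \<comment> \<open>At negative times both solutions are \<open>undefined\<close> by
      extensionality.\<close>
    then show ?thesis using sol unfolding galerkin_solution_iff[OF f] by (auto simp: PiE_def extensional_def)
  next
    case True
    obtain CU CV where CU: "\<And>s x. s \<in> {0..T} \<Longrightarrow> x \<in> {-pi..pi} \<Longrightarrow> \<bar>deriv (U s) x\<bar> \<le> CU"
      and CV: "\<And>s x. s \<in> {0..T} \<Longrightarrow> x \<in> {-pi..pi} \<Longrightarrow> \<bar>deriv (V s) x\<bar> \<le> CV"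
      using real_trig_space_curve_deriv_bounded[OF U dU] real_trig_space_curve_deriv_bounded[OF V dV] by metis
    define y where "y s = (LINT x|period_measure. (U s x - V s x)\<^sup>2)" for s
    define y' where "y' t = - (1 / 2) * (LINT x|period_measure. (deriv (U t) x + deriv (V t) x) * (U t x - V t x)\<^sup>2)" for t
    have "y T \<le> 0"
    proof (rule gronwall_zero[OF _ _ _ True])
      show "y 0 = 0" by (simp add: y_def init)
      fix t assume t: "0 \<le> t" "t \<le> T"
      note u = U[OF t(1)] and v = V[OF t(1)]
      define P where "P = time_deriv U t"
      define Q where "Q = time_deriv V t"
      have P: "P \<in> real_trig_space N" and tdU: "time_diff t U P"
        using real_trig_space_curve(1)[OF U t(1) dU[OF t(1)]] real_trig_space_curve(2)[OF U t(1) dU[OF t(1)], of 0]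
        by (simp_all add: P_def)
      have Q: "Q \<in> real_trig_space N" and tdV: "time_diff t V Q"
        using real_trig_space_curve(1)[OF V t(1) dV[OF t(1)]] real_trig_space_curve(2)[OF V t(1) dV[OF t(1)], of 0]
        by (simp_all add: Q_def)
      note [continuous_intros] = continuous_on_kawahara[OF u] continuous_on_kawahara[OF v] continuous_on_trig_derivs[OF u]
        continuous_on_trig_derivs[OF v] continuous_on_trig_derivs[OF P] continuous_on_trig_derivs[OF Q]
      have "time_diff t (\<lambda>s x. U s x - V s x) (\<lambda>x. P x - Q x)"
        using time_diff.add[OF tdU time_diff_cmult[OF tdV, of "- 1"]] by (rule time_diff.cong) simp_all
      from time_diff_mult[OF t(1) this this]
      have "time_diff t (\<lambda>s x. (U s x - V s x)\<^sup>2) (\<lambda>x. 2 * ((P x - Q x) * (U t x - V t x)))"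
        by (rule time_diff.cong) (simp_all add: power2_eq_square algebra_simps)
      from time_diff_integral[OF t(1) this]
      have dy: "(y has_real_derivative 2 * (LINT x|period_measure. (P x - Q x) * (U t x - V t x))) (at t within {0..})"
        unfolding y_def[abs_def] by simp
      \<comment> \<open>Both weak equations are tested with the difference of the solutions and
        subtracted.\<close>
      have "(LINT x|period_measure. (P x + kawahara_op (U t) x) * (U t x - V t x)
          - (Q x + kawahara_op (V t) x) * (U t x - V t x)) = 0"
        using wU[OF t(1) real_trig_space_diff[OF u v]] wV[OF t(1) real_trig_space_diff[OF u v]]
        by (subst Bochner_Integration.integral_diff)
          (auto simp: P_def[symmetric] Q_def[symmetric] intro!: continuous_imp_integrable_real continuous_intros)
      also have "(\<lambda>x. (P x + kawahara_op (U t) x) * (U t x - V t x) - (Q x + kawahara_op (V t) x) * (U t x - V t x))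
          = (\<lambda>x. (P x - Q x) * (U t x - V t x) + (kawahara_op (U t) x - kawahara_op (V t) x) * (U t x - V t x))"
        by (simp add: algebra_simps)
      also have "(LINT x|period_measure. \<dots> x) = (LINT x|period_measure. (P x - Q x) * (U t x - V t x))
          + (LINT x|period_measure. (kawahara_op (U t) x - kawahara_op (V t) x) * (U t x - V t x))"
        by (intro Bochner_Integration.integral_add continuous_imp_integrable_real continuous_intros)
      finally show "(y has_real_derivative y' t) (at t within {0..})"
        using dy unfolding integral_kawahara_op_diff[OF u v] y'_def by (simp add: add_eq_0_iff)
      have "(LINT x|period_measure. - ((deriv (U t) x + deriv (V t) x) * (U t x - V t x)\<^sup>2))
          \<le> (LINT x|period_measure. (CU + CV) * (U t x - V t x)\<^sup>2)"
      proof (intro integral_mono continuous_imp_integrable_real continuous_intros)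
        fix x assume "x \<in> space period_measure"
        then have "- (deriv (U t) x + deriv (V t) x) \<le> CU + CV"
          using CU[of t x] CV[of t x] t by (auto simp: abs_le_iff)
        from mult_right_mono[OF this, of "(U t x - V t x)\<^sup>2"]
        show "- ((deriv (U t) x + deriv (V t) x) * (U t x - V t x)\<^sup>2) \<le> (CU + CV) * (U t x - V t x)\<^sup>2"
          by (simp only: minus_mult_left zero_le_power2)
      qed
      then show "y' t \<le> (CU + CV) / 2 * y t"
        unfolding y'_def y_def by simp
    qed
    \<comment> \<open>Passing through the node values gives equality at every x, not merely almost
      everywhere.\<close>
    moreover have "y T = 2 * pi / (2 * N + 1) * (\<Sum>j\<le>2*N. (U T (node N j) - V T (node N j))\<^sup>2)"
      using integral_real_trig_space_mult[OF real_trig_space_diff[OF U[OF True] V[OF True]]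
          real_trig_space_diff[OF U[OF True] V[OF True]]]
      by (simp add: y_def power2_eq_square)
    moreover have "0 < 2 * pi / real (2 * N + 1)"
      by (intro divide_pos_pos of_nat_0_less_iff[THEN iffD2]) auto
    ultimately have "(\<Sum>j\<le>2*N. (U T (node N j) - V T (node N j))\<^sup>2) \<le> 0"
      by (metis mult_pos_pos not_le)
    then have "(\<Sum>j\<le>2*N. (U T (node N j) - V T (node N j))\<^sup>2) = 0"
      by (simp add: order_antisym sum_nonneg)
    then have "U T (node N j) = V T (node N j)" if "j \<le> 2 * N" for j
      using that by (simp add: sum_nonneg_eq_0_iff)
    then have eq: "(\<Sum>j\<le>2*N. U T (node N j) * nodal N j x) = (\<Sum>j\<le>2*N. V T (node N j) * nodal N j x)" for x
      by (intro sum.cong) auto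
    show ?thesis
    proof
      fix x
      show "U T x = V T x"
        using real_trig_space_interpolation[OF U[OF True], of x] real_trig_space_interpolation[OF V[OF True], of x] eq[of x]
        by linarith
    qed
  qed
qed

section \<open>Existence in nodal coordinates\<close>

lemma nodal_combination_node:
  assumes "l \<le> 2 * N"
  shows "(\<Sum>j\<le>2*N. c j * nodal N j (node N l)) = c l"
proof -
  have "(\<Sum>j\<le>2*N. c j * nodal N j (node N l)) = (\<Sum>j\<le>2*N. if j = l then c j else 0)"
    using assms by (intro sum.cong) (auto simp: nodal_node)
  then show ?thesis using assms by simp
qed

text \<open>Brings the field into the quadratic plus linear shape that
  \<open>conservative_quadratic_ode_global_solution\<close> expects.\<close>

lemma integral_kawahara_op_nodal_combination:
  fixes c :: "nat \<Rightarrow> real" and N :: nat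
  defines "v \<equiv> \<lambda>x. \<Sum>i\<le>2*N. c i * nodal N i x"
  shows "(LINT x|period_measure. kawahara_op v x * nodal N j x)
    = (\<Sum>i\<le>2*N. \<Sum>k\<le>2*N. (LINT x|period_measure. nodal N i x * deriv (nodal N k) x * nodal N j x) * (c i * c k))
      + (\<Sum>i\<le>2*N. (LINT x|period_measure. ((deriv ^^ 3) (nodal N i) x - (deriv ^^ 5) (nodal N i) x) * nodal N j x) * c i)"
proof -
  note [continuous_intros] = continuous_on_trig_derivs[OF nodal_in_real_trig_space]
  have deriv_v: "(deriv ^^ n) v = (\<lambda>x. \<Sum>i\<le>2*N. c i * (deriv ^^ n) (nodal N i) x)" for n
    unfolding v_def by (rule deriv_power_sum) (auto intro: nodal_in_real_trig_space)
  have "deriv v = (\<lambda>x. \<Sum>i\<le>2*N. c i * deriv (nodal N i) x)"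
    using deriv_v[of 1] by simp
  moreover have "(\<Sum>i\<in>I. c i * A i) * (\<Sum>k\<in>I. c k * B k) * d = (\<Sum>i\<in>I. \<Sum>k\<in>I. A i * B k * d * (c i * c k))"
    for I :: "nat set" and A B :: "nat \<Rightarrow> real" and d :: real
    unfolding sum_product unfolding sum_distrib_right by (simp only: mult_ac)
  moreover have "((\<Sum>i\<in>I. c i * A i) - (\<Sum>i\<in>I. c i * B i)) * d = (\<Sum>i\<in>I. (A i - B i) * d * c i)"
    for I :: "nat set" and A B :: "nat \<Rightarrow> real" and d :: real
    unfolding sum_subtractf[symmetric] sum_distrib_right by (rule sum.cong) (simp_all add: algebra_simps)
  ultimately have "kawahara_op v x * nodal N j x
    = (\<Sum>i\<le>2*N. \<Sum>k\<le>2*N. nodal N i x * deriv (nodal N k) x * nodal N j x * (c i * c k))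
      + (\<Sum>i\<le>2*N. ((deriv ^^ 3) (nodal N i) x - (deriv ^^ 5) (nodal N i) x) * nodal N j x * c i)" for x
    unfolding kawahara_op_def deriv_v add_diff_eq[symmetric] distrib_right
    by (simp only: v_def)
  moreover have "integrable period_measure (\<lambda>x. nodal N i x * deriv (nodal N k) x * nodal N j x * d)"
    "integrable period_measure (\<lambda>x. ((deriv ^^ 3) (nodal N i) x - (deriv ^^ 5) (nodal N i) x) * nodal N j x * d)" for i k d
    by (intro continuous_imp_integrable_real continuous_intros)+
  ultimately show ?thesis
    by (simp add: Bochner_Integration.integral_sum Bochner_Integration.integral_add)
qed

lemma galerkin_exists:
  assumes f: "square_integrable_per f"
  obtains U where "galerkin_solution N f U"
proof -
  \<comment> \<open>The reciprocal of the squared norm of a basis function: it converts a pairing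
    with \<open>nodal N j\<close> into the value at node j. The minus signs in \<open>Q\<close> and
    \<open>K\<close> come from solving the equation for the time derivative.\<close>
  define \<mu> where "\<mu> = (2 * real N + 1) / (2 * pi)"
  define v where "v c x = (\<Sum>i\<le>2*N. c i * nodal N i x)" for c x
  define Q where "Q j i k = - \<mu> * (LINT x|period_measure. nodal N i x * deriv (nodal N k) x * nodal N j x)" for j i k
  define K where "K j i = - \<mu> * (LINT x|period_measure. ((deriv ^^ 3) (nodal N i) x - (deriv ^^ 5) (nodal N i) x) * nodal N j x)" for j i
  have v: "v c \<in> real_trig_space N" for c
    unfolding v_def[abs_def] by (intro real_trig_space_sum nodal_in_real_trig_space) simp
  have F: "(\<Sum>i<Suc (2*N). \<Sum>k<Suc (2*N). Q j i k * (c i * c k)) + (\<Sum>i<Suc (2*N). K j i * c i)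
      = - \<mu> * (LINT x|period_measure. kawahara_op (v c) x * nodal N j x)" for c j
    unfolding lessThan_Suc_atMost v_def[abs_def] integral_kawahara_op_nodal_combination Q_def K_def
    by (simp only: distrib_left sum_distrib_left mult.assoc)
  have int: "integrable period_measure (\<lambda>x. kawahara_op (v c) x * nodal N j x)" for c j
    by (intro integrable_trig_nodal continuous_on_kawahara[OF v])
  have cons: "(\<Sum>j<Suc (2*N). c j * ((\<Sum>i<Suc (2*N). \<Sum>k<Suc (2*N). Q j i k * (c i * c k)) + (\<Sum>i<Suc (2*N). K j i * c i))) = 0" for c
  proof -
    \<comment> \<open>Weighting the equations by the coordinates \<open>c\<close> amounts to testing
      with \<open>v c\<close> itself.\<close>
    have "(LINT x|period_measure. kawahara_op (v c) x * (\<Sum>j\<le>2*N. c j * nodal N j x)) = 0"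
      using integral_kawahara_op_self[OF v[of c]] by (simp add: v_def)
    then have "(\<Sum>j\<le>2*N. c j * (LINT x|period_measure. kawahara_op (v c) x * nodal N j x)) = 0"
      by (subst (asm) integral_times_linear_combination) (rule int)
    then have "- \<mu> * (\<Sum>j\<le>2*N. c j * (LINT x|period_measure. kawahara_op (v c) x * nodal N j x)) = 0"
      by simp
    then show ?thesis
      unfolding F unfolding lessThan_Suc_atMost sum_distrib_left by (simp only: mult.left_commute)
  qed
  obtain a where a0: "\<And>j. j \<le> 2 * N \<Longrightarrow> a j 0 = real_proj N f (node N j)"
    and da: "\<And>j t. j \<le> 2 * N \<Longrightarrow> 0 \<le> t \<Longrightarrow> (a j has_real_derivative
      - \<mu> * (LINT x|period_measure. kawahara_op (v (\<lambda>i. a i t)) x * nodal N j x)) (at t within {0..})"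
    using conservative_quadratic_ode_global_solution[OF cons, of "\<lambda>j. real_proj N f (node N j)"]
    unfolding F less_Suc_eq_le by metis
  \<comment> \<open>The value at negative times is the one that extensionality prescribes.\<close>
  define U where "U t = (if 0 \<le> t then v (\<lambda>i. a i t) else undefined)" for t
  define W where "W t = v (\<lambda>j. - \<mu> * (LINT x|period_measure. kawahara_op (v (\<lambda>i. a i t)) x * nodal N j x))" for t
  have dU: "((\<lambda>s. U s x) has_real_derivative W t x) (at t within {0..})" if "0 \<le> t" for t x
  proof -
    have "((\<lambda>s. v (\<lambda>i. a i s) x) has_real_derivative W t x) (at t within {0..})"
      unfolding v_def[of _ x] W_def by (intro DERIV_sum DERIV_cmult_right da that) simp
    then show ?thesis
      by (rule has_field_derivative_transform_within[OF _ zero_less_one]) (use that in \<open>auto simp: U_def\<close>)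
  qed
  have td: "time_deriv U t = W t" if "0 \<le> t" for t
    by (rule ext) (rule time_deriv_eqI[OF that dU[OF that]])
  have "galerkin_solution N f U"
    unfolding galerkin_solution_iff[OF f]
  proof (intro conjI allI impI ballI)
    show "U \<in> {0..} \<rightarrow>\<^sub>E real_trig_space N"
      by (auto simp: U_def v)
    show "(\<lambda>s. U s x) differentiable (at t within {0..})" if "0 \<le> t" for t x
      using dU[OF that] by (auto simp: real_differentiable_def)
    show "U 0 = real_proj N f"
    proof
      fix x
      have "U 0 x = (\<Sum>j\<le>2*N. real_proj N f (node N j) * nodal N j x)"
        by (simp add: U_def v_def a0)
      then show "U 0 x = real_proj N f x"
        by (simp only: real_trig_space_interpolation[OF real_proj_in_real_trig_space, symmetric])
    qed
  next
    fix t :: real and \<psi>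
    assume t: "0 \<le> t" and \<psi>: "\<psi> \<in> real_trig_space N"
    let ?u = "v (\<lambda>i. a i t)"
    have intW: "integrable period_measure (\<lambda>x. W t x * nodal N j x)" for j
      unfolding W_def by (intro integrable_trig_nodal continuous_on_real_trig_space[OF v])
    have "(LINT x|period_measure. W t x * nodal N j x) = - (LINT x|period_measure. kawahara_op ?u x * nodal N j x)"
      if j: "j \<le> 2 * N" for j
    proof -
      have "W t (node N j) = - \<mu> * (LINT x|period_measure. kawahara_op ?u x * nodal N j x)"
        unfolding W_def by (subst (1) v_def) (rule nodal_combination_node[OF j])
      moreover have "(LINT x|period_measure. W t x * nodal N j x) = 2 * pi / (2 * N + 1) * W t (node N j)"
        unfolding W_def by (rule integral_real_trig_space_nodal[OF v])
      ultimately show ?thesis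
        using node_weight_cancel[of N "- (LINT x|period_measure. kawahara_op ?u x * nodal N j x)"]
        by (simp only: \<mu>_def mult_minus_left mult_minus_right)
    qed
    then have "(LINT x|period_measure. (W t x + kawahara_op ?u x) * nodal N j x) = 0" if "j \<le> 2 * N" for j
      using that intW int by (simp add: distrib_right)
    moreover have "integrable period_measure (\<lambda>x. (W t x + kawahara_op ?u x) * nodal N j x)" for j
      using intW int by (simp add: distrib_right)
    ultimately show "(LINT x|period_measure. (time_deriv U t x + kawahara_op (U t) x) * \<psi> x) = 0"
      using t by (simp add: td U_def integral_times_real_trig_space[OF _ \<psi>])
  qed
  then show ?thesis by (rule that)
qed

theorem lemma3p1:
  fixes N :: nat and f :: "real \<Rightarrow> real"
  assumes "N \<ge> 1"
    and "square_integrable_per f"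
    and "periodic_2pi f"
  shows "(\<exists>!U. galerkin_solution N f U) \<and>
    (\<forall>U. galerkin_solution N f U \<longrightarrow> (\<forall>t\<ge>0.
       ((\<lambda>s. LINT x|period_measure. U s x) has_real_derivative 0) (at t within {0..}) \<and>
       ((\<lambda>s. LINT x|period_measure. (U s x)\<^sup>2) has_real_derivative 0) (at t within {0..}) \<and>
       ((\<lambda>s. LINT x|period_measure.
            1 / 3 * (U s x) ^ 3 - (deriv (U s) x)\<^sup>2 - ((deriv ^^ 2) (U s) x)\<^sup>2)
          has_real_derivative 0) (at t within {0..})))"
proof (intro conjI allI impI)
  show "\<exists>!U. galerkin_solution N f U"
    using galerkin_exists[OF assms(2)] galerkin_unique[OF assms(2)] by metis
qed (rule galerkin_conservation[OF assms(2)], assumption+)+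

end
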